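(* Assuming the Continuum Hypothesis, there is a compact (Hausdorff) space $K$ such that $Seq^1(\mathrm{co}\,\Delta_K)\neq Seq(\mathrm{co}\,\Delta_K)=P(K)$.
   Context: For a compact space $K$, $M(K)=C(K)^*$ is the space of Radon signed measures on $K$ with the weak$^*$ topology, $P(K)$ is the set of Radon probability measures, $\delta_t$ is the Dirac measure at $t\in K$, $\Delta_K=\{\delta_t:t\in K\}$, and $\mathrm{co}\,\Delta_K$ is its convex hull. For $A\subseteq M(K)$: $Seq^0(A)=A$, $Seq^{\alpha+1}(A)$ is the set of limits of weak$^*$-convergent sequences in $Seq^\alpha(A)$, $Seq^\alpha(A)=\bigcup_{\beta<\alpha}Seq^\beta(A)$ for limit $\alpha$, and $Seq(A)=Seq^{\omega_1}(A)$ is the sequential closure of $A$ (the smallest subset of $M(K)$ containing $A$ and closed under limits of weak$^*$-convergent sequences). *)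

theory Defs
  imports "HOL-Analysis.Analysis" "HOL-Library.Equipollence"
begin

definition CH :: bool where
  "CH \<longleftrightarrow> (\<forall>A :: real set. countable A \<or> A \<approx> (UNIV :: real set))"

definition cfun :: "'a topology \<Rightarrow> ('a \<Rightarrow> real) set" where
  "cfun X = {f. continuous_map X euclideanreal f \<and> (\<forall>x. x \<notin> topspace X \<longrightarrow> f x = 0)}"

text \<open>M(K) = C(K)^*: bounded linear functionals on C(K) (extensional: 0 off C(K)).\<close>
definition meas :: "'a topology \<Rightarrow> (('a \<Rightarrow> real) \<Rightarrow> real) set" where
  "meas X = {\<phi>.
     (\<forall>f\<in>cfun X. \<forall>g\<in>cfun X. \<forall>a b::real.
        \<phi> (\<lambda>x. a * f x + b * g x) = a * \<phi> f + b * \<phi> g)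
   \<and> (\<exists>B. \<forall>f\<in>cfun X. (\<forall>x\<in>topspace X. \<bar>f x\<bar> \<le> 1) \<longrightarrow> \<bar>\<phi> f\<bar> \<le> B)
   \<and> (\<forall>f. f \<notin> cfun X \<longrightarrow> \<phi> f = 0)}"

definition wconv :: "'a topology \<Rightarrow> (nat \<Rightarrow> ('a \<Rightarrow> real) \<Rightarrow> real) \<Rightarrow> (('a \<Rightarrow> real) \<Rightarrow> real) \<Rightarrow> bool" where
  "wconv X s \<mu> \<longleftrightarrow> (\<forall>f\<in>cfun X. (\<lambda>n. s n f) \<longlonglongrightarrow> \<mu> f)"

definition dirac :: "'a topology \<Rightarrow> 'a \<Rightarrow> ('a \<Rightarrow> real) \<Rightarrow> real" where
  "dirac X t = (\<lambda>f. if f \<in> cfun X then f t else 0)"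

definition coDelta :: "'a topology \<Rightarrow> (('a \<Rightarrow> real) \<Rightarrow> real) set" where
  "coDelta X = {\<phi>. \<exists>(n::nat) (c::nat \<Rightarrow> real) (t::nat \<Rightarrow> 'a).
      (\<forall>i<n. 0 \<le> c i \<and> t i \<in> topspace X) \<and> (\<Sum>i<n. c i) = 1 \<and>
      \<phi> = (\<lambda>f. \<Sum>i<n. c i * dirac X (t i) f)}"

text \<open>P(K): positive functionals with value 1 at the constant function 1 (Riesz).\<close>
definition probm :: "'a topology \<Rightarrow> (('a \<Rightarrow> real) \<Rightarrow> real) set" where
  "probm X = {\<phi> \<in> meas X.
      (\<forall>f\<in>cfun X. (\<forall>x\<in>topspace X. 0 \<le> f x) \<longrightarrow> 0 \<le> \<phi> f)
    \<and> \<phi> (\<lambda>x. if x \<in> topspace X then 1 else 0) = 1}"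

definition seq1 :: "'a topology \<Rightarrow> (('a \<Rightarrow> real) \<Rightarrow> real) set \<Rightarrow> (('a \<Rightarrow> real) \<Rightarrow> real) set" where
  "seq1 X A = {\<mu> \<in> meas X. \<exists>s. (\<forall>n. s n \<in> A) \<and> wconv X s \<mu>}"

inductive_set seqcl :: "'a topology \<Rightarrow> (('a \<Rightarrow> real) \<Rightarrow> real) set \<Rightarrow> (('a \<Rightarrow> real) \<Rightarrow> real) set"
  for X A where
  base: "\<mu> \<in> A \<Longrightarrow> \<mu> \<in> seqcl X A"
| lim: "(\<And>n. s n \<in> seqcl X A) \<Longrightarrow> \<mu> \<in> meas X \<Longrightarrow> wconv X s \<mu> \<Longrightarrow> \<mu> \<in> seqcl X A"

end

theory Submission
  imports Defs
begin

text \<open>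
  On \<open>\<nat> \<times> \<nat>\<close> let \<open>\<lambda>\<^sub>n\<close> be the dyadic (Haar) density on the layer \<open>{n} \<times> \<nat>\<close>, a limit of
  finitely supported measures. By recursion along an \<open>\<omega>\<^sub>1\<close>-ordering of the reals one builds a Boolean
  algebra on which \<open>\<lambda>\<^sub>n\<close> converges to some \<open>\<mu>\<close>; \<open>K\<close> is its Stone space. The set added at a stage
  kills one candidate \<open>\<nu>\<^sub>k \<rightarrow> \<mu>\<close> of finitely supported measures: it has \<open>\<mu>\<close>-measure at most \<open>1/4\<close>
  but swallows more than half of infinitely many \<open>\<nu>\<^sub>k\<close>. So \<open>\<mu>\<close> has sequential order exactly two.
  At the same time, stages commit to sequences \<open>S\<^sub>j\<close> with \<open>\<mu>(S\<^sub>j) \<le> 2\<^sup>-\<^sup>j\<close>: every later set meets almost all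
  \<open>S\<^sub>j\<close> in a set of its own stage, so that points lying in infinitely many \<open>S\<^sub>j\<close> are never split
  again. An arbitrary probability \<open>p\<close> is then reached as follows: off sets \<open>S\<^sub>j\<close> of small \<open>\<mu>\<close>-measure it is
  close to a simple density times \<open>\<mu>\<close>, and on \<open>S\<^sub>j\<close>, once committed, it is approximated by finitely
  supported measures. Since functionals on \<open>C(K)\<close> are determined by clopen sets, everything is done
  with finitely additive set functions.
\<close>

section \<open>Finitely additive set functions\<close>

lemma algebra_UNIV_I:
  assumes "{} \<in> M" "\<And>A. A \<in> M \<Longrightarrow> - A \<in> M" "\<And>A B. A \<in> M \<Longrightarrow> B \<in> M \<Longrightarrow> A \<inter> B \<in> M"
  shows "algebra UNIV M"
  using assms by (auto simp: algebra_iff_Int Compl_eq_Diff_UNIV)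

lemma algebra_UNIV_compl: "algebra UNIV M \<Longrightarrow> A \<in> M \<Longrightarrow> - A \<in> M"
  by (metis Compl_eq_Diff_UNIV algebra.compl_sets)

inductive_set balg :: "'a set set \<Rightarrow> 'a set set" for G where
  gen: "A \<in> G \<Longrightarrow> A \<in> balg G"
| empty: "{} \<in> balg G"
| compl: "A \<in> balg G \<Longrightarrow> - A \<in> balg G"
| inter: "A \<in> balg G \<Longrightarrow> B \<in> balg G \<Longrightarrow> A \<inter> B \<in> balg G"

lemma algebra_balg: "algebra UNIV (balg G)"
  by (rule algebra_UNIV_I) (auto intro: balg.intros)

lemma balg_least:
  assumes "algebra UNIV N" "G \<subseteq> N"
  shows "balg G \<subseteq> N"
proof
  fix A assume "A \<in> balg G"
  then show "A \<in> N"
  proof induction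
    case (compl A)
    then show ?case using algebra_UNIV_compl[OF assms(1)] by auto
  next
    case (inter A B)
    interpret algebra UNIV N by fact
    show ?case using inter by auto
  next
    case empty
    interpret algebra UNIV N by fact
    show ?case by auto
  qed (use assms in auto)
qed

lemma balg_mono: "G \<subseteq> H \<Longrightarrow> balg G \<subseteq> balg H"
  by (rule balg_least[OF algebra_balg]) (auto intro: balg.gen)

text \<open>Complement and intersection are applied in countably many rounds; each round keeps the
  family countable, and the union of all rounds is an algebra.\<close>

lemma countable_balg:
  assumes "countable G"
  shows "countable (balg G)"
proof -
  define step where "step = (\<lambda>H::'a set set. H \<union> uminus ` H \<union> (\<lambda>(A,B). A \<inter> B) ` (H \<times> H))"
  define C where "C = (\<lambda>n. (step ^^ n) (insert {} G))"
  have cnt: "countable (C n)" for n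
  proof (induction n)
    case 0
    then show ?case using assms by (auto simp: C_def)
  next
    case (Suc n)
    have "C (Suc n) = step (C n)" by (simp add: C_def)
    then show ?case using Suc by (auto simp: step_def)
  qed
  have S: "C (Suc n) = step (C n)" for n by (simp add: C_def)
  have mono: "n \<le> m \<Longrightarrow> C n \<subseteq> C m" for n m
    by (rule lift_Suc_mono_le[of C]) (auto simp: S step_def)
  have "algebra UNIV (\<Union>n. C n)"
  proof (rule algebra_UNIV_I)
    show "{} \<in> (\<Union>n. C n)" by (auto simp: C_def intro!: exI[of _ 0])
  next
    fix A assume "A \<in> (\<Union>n. C n)"
    then obtain n where "A \<in> C n" by auto
    then have "- A \<in> C (Suc n)" by (auto simp: S step_def)
    then show "- A \<in> (\<Union>n. C n)" by blast
  next
    fix A B assume "A \<in> (\<Union>n. C n)" "B \<in> (\<Union>n. C n)"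
    then obtain n m where "A \<in> C n" "B \<in> C m" by auto
    then have "A \<in> C (max n m)" "B \<in> C (max n m)" using mono[of n "max n m"] mono[of m "max n m"] by auto
    then have "A \<inter> B \<in> C (Suc (max n m))" unfolding S step_def by force
    then show "A \<inter> B \<in> (\<Union>n. C n)" by blast
  qed
  moreover have "G \<subseteq> (\<Union>n. C n)" by (auto simp: C_def intro!: exI[of _ 0])
  ultimately have "balg G \<subseteq> (\<Union>n. C n)" by (rule balg_least)
  then show ?thesis using cnt by (auto intro: countable_subset)
qed

text \<open>Complement and intersection act separately inside and outside \<open>a\<close>, so the
  sets of this shape already form an algebra.\<close>

lemma balg_insert:
  assumes "algebra UNIV N" "A \<in> balg (insert a N)"
  shows "\<exists>B\<in>N. \<exists>B'\<in>N. A = (B \<inter> a) \<union> (B' - a)"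
proof -
  interpret algebra UNIV N by fact
  define W where "W = {A. \<exists>B\<in>N. \<exists>B'\<in>N. A = (B \<inter> a) \<union> (B' - a)}"
  have "algebra UNIV W"
  proof (rule algebra_UNIV_I)
    show "{} \<in> W" by (auto simp: W_def intro!: bexI[of _ "{}"])
  next
    fix A assume "A \<in> W"
    then obtain B B' where B: "B \<in> N" "B' \<in> N" "A = (B \<inter> a) \<union> (B' - a)" by (auto simp: W_def)
    then have "- A = ((-B) \<inter> a) \<union> ((-B') - a)" by blast
    then show "- A \<in> W" using B(1,2) algebra_UNIV_compl[OF assms(1)] by (auto simp: W_def)
  next
    fix A A' assume "A \<in> W" "A' \<in> W"
    then obtain B B' C C' where B: "B \<in> N" "B' \<in> N" "A = (B \<inter> a) \<union> (B' - a)"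
       "C \<in> N" "C' \<in> N" "A' = (C \<inter> a) \<union> (C' - a)" unfolding W_def by blast
    then have "A \<inter> A' = ((B\<inter>C) \<inter> a) \<union> ((B' \<inter> C') - a)" by blast
    then show "A \<inter> A' \<in> W" using B unfolding W_def by blast
  qed
  moreover have "insert a N \<subseteq> W"
  proof
    fix A assume "A \<in> insert a N"
    then consider "A = a" | "A \<in> N" by auto
    then show "A \<in> W"
    proof cases
      case 1
      then have "A = (UNIV \<inter> a) \<union> ({} - a)" by auto
      then show ?thesis unfolding W_def by blast
    next
      case 2
      have "A = (A \<inter> a) \<union> (A - a)" by auto
      then show ?thesis using 2 unfolding W_def by blast
    qed
  qed
  ultimately have "balg (insert a N) \<subseteq> W" by (rule balg_least)
  then show ?thesis using assms(2) by (auto simp: W_def)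
qed

section \<open>Nonnegative finitely additive set functions\<close>

text \<open>\<open>p\<close> is a total function constrained only on \<open>M\<close>, so the same
  function can be used on several algebras.\<close>

locale fin_add = algebra UNIV M for M :: "'a set set" +
  fixes p :: "'a set \<Rightarrow> real"
  assumes nonneg: "A \<in> M \<Longrightarrow> 0 \<le> p A"
    and add: "A \<in> M \<Longrightarrow> B \<in> M \<Longrightarrow> A \<inter> B = {} \<Longrightarrow> p (A \<union> B) = p A + p B"
begin

lemma p_empty: "p {} = 0"
  using add[of "{}" "{}"] by auto

lemma compl_closed: "A \<in> M \<Longrightarrow> - A \<in> M"
  by (rule algebra_UNIV_compl) (rule algebra_axioms)

lemma split: "A \<in> M \<Longrightarrow> B \<in> M \<Longrightarrow> p A = p (A \<inter> B) + p (A - B)"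
  using add[of "A \<inter> B" "A - B"] by (auto simp: Int_Diff_Un)

lemma mono: "A \<in> M \<Longrightarrow> B \<in> M \<Longrightarrow> A \<subseteq> B \<Longrightarrow> p A \<le> p B"
  using split[of B A] nonneg[of "B - A"] by (auto simp: Int_absorb1)

lemma diff: "A \<in> M \<Longrightarrow> B \<in> M \<Longrightarrow> B \<subseteq> A \<Longrightarrow> p (A - B) = p A - p B"
  using split[of A B] by (auto simp: Int_absorb1)

lemma subadd: "A \<in> M \<Longrightarrow> B \<in> M \<Longrightarrow> p (A \<union> B) \<le> p A + p B"
  using add[of A "B - A"] mono[of "B - A" B] Diff[of B A] by auto

lemma subadd_UN:
  "finite I \<Longrightarrow> (\<And>i. i \<in> I \<Longrightarrow> A i \<in> M) \<Longrightarrow> p (\<Union>i\<in>I. A i) \<le> (\<Sum>i\<in>I. p (A i))"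
proof (induction I rule: finite_induct)
  case (insert x F)
  have "p (A x \<union> (\<Union>i\<in>F. A i)) \<le> p (A x) + p (\<Union>i\<in>F. A i)"
    using insert.hyps insert.prems by (intro subadd finite_UN) auto
  moreover have "p (\<Union>i\<in>F. A i) \<le> (\<Sum>i\<in>F. p (A i))" using insert.IH insert.prems by simp
  ultimately show ?case using insert.hyps by simp
qed (simp add: p_empty)

lemma subalgebra: "fin_add N p" if "algebra UNIV N" "N \<subseteq> M"
proof -
  interpret N: algebra UNIV N by fact
  show ?thesis
  proof
    show "A \<in> N \<Longrightarrow> 0 \<le> p A" for A using that(2) nonneg by blast
    show "A \<in> N \<Longrightarrow> B \<in> N \<Longrightarrow> A \<inter> B = {} \<Longrightarrow> p (A \<union> B) = p A + p B" for A B
      using that(2) add by blast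
  qed
qed

end

section \<open>Finitely supported measures\<close>

text \<open>Masses are not normalised, which keeps the class stable under sums, scaling and
  restriction.\<close>

inductive_set atomic :: "('a set \<Rightarrow> real) set" where
  zero: "(\<lambda>A. 0) \<in> atomic"
| plus: "q \<in> atomic \<Longrightarrow> 0 \<le> c \<Longrightarrow> (\<lambda>A. q A + c * indicator A d) \<in> atomic"

lemma atomic_point: "0 \<le> c \<Longrightarrow> (\<lambda>A. c * indicator A d) \<in> atomic"
  using atomic.plus[OF atomic.zero] by simp

lemma atomic_add:
  assumes "q \<in> atomic" "r \<in> atomic"
  shows "(\<lambda>A. q A + r A) \<in> atomic"
  using assms(2)
proof induction
  case (plus r c d)
  then show ?case using atomic.plus[of "\<lambda>A. q A + r A" c d] by (simp add: add.assoc)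
qed (use assms in auto)

lemma atomic_scale:
  assumes "q \<in> atomic" "0 \<le> c"
  shows "(\<lambda>A. c * q A) \<in> atomic"
  using assms(1)
proof induction
  case (plus r e d)
  then show ?case using atomic.plus[of "\<lambda>A. c * r A" "c*e" d] assms by (simp add: algebra_simps)
qed (use atomic.zero in auto)

lemma atomic_sum:
  assumes "finite I" "\<And>i. i \<in> I \<Longrightarrow> q i \<in> atomic"
  shows "(\<lambda>A. \<Sum>i\<in>I. q i A) \<in> atomic"
  using assms
proof (induction I rule: finite_induct)
  case (insert x F)
  then show ?case using atomic_add[of "q x" "\<lambda>A. \<Sum>i\<in>F. q i A"] by simp
qed (use atomic.zero in auto)

lemma atomic_restrict:
  assumes "q \<in> atomic"
  shows "(\<lambda>A. q (A \<inter> C)) \<in> atomic"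
  using assms
proof induction
  case (plus r e d)
  have "(\<lambda>A. r (A \<inter> C) + e * indicator (A \<inter> C) d) = (\<lambda>A. r (A \<inter> C) + (e * indicator C d) * indicator A d)"
    by (auto simp: indicator_def)
  then show ?case using atomic.plus[of "\<lambda>A. r (A \<inter> C)" "e * indicator C d" d] plus by (simp)
qed (use atomic.zero in auto)

lemma atomic_fin_add:
  assumes "q \<in> atomic" shows "fin_add UNIV q"
proof -
  have "(\<forall>A. 0 \<le> q A) \<and> (\<forall>A B. A \<inter> B = {} \<longrightarrow> q (A \<union> B) = q A + q B)"
    using assms
  proof induction
    case (plus q c d)
    then show ?case by (auto simp: indicator_def algebra_simps)
  qed auto
  moreover have "algebra UNIV (UNIV::'a set set)" by (rule algebra_UNIV_I) auto
  ultimately show ?thesis by (auto simp: fin_add_def fin_add_axioms_def)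
qed

context fin_add begin

text \<open>Each member of \<open>F\<close> splits \<open>E\<close> in two and the parts are treated
  separately; at the end the mass of a nonempty part goes to any of its points. Concentration on
  \<open>E\<close> is what allows the two parts to be added.\<close>

lemma atomic_approx:
  assumes "finite F" "F \<subseteq> M" "E \<in> M"
  shows "\<exists>q\<in>atomic. (\<forall>A. q A = q (A \<inter> E)) \<and> q UNIV = p E \<and> (\<forall>B\<in>F. q B = p (B \<inter> E))"
  using assms
proof (induction F arbitrary: E rule: finite_induct)
  case empty
  show ?case
  proof (cases "E = {}")
    case True
    then show ?thesis using atomic.zero p_empty by (intro bexI[of _ "\<lambda>A. 0"]) auto
  next
    case False
    then obtain e where "e \<in> E" by auto
    then show ?thesis using atomic_point[of "p E" e] nonneg empty
      by (intro bexI[of _ "\<lambda>A. p E * indicator A e"]) (auto simp: indicator_def)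
  qed
next
  case (insert B0 F)
  have E: "E \<in> M" "B0 \<in> M" "F \<subseteq> M" using insert.prems by auto
  have EB: "E \<inter> B0 \<in> M" "E - B0 \<in> M" using E by blast+
  obtain q where q: "q \<in> atomic" "\<And>A. q A = q (A \<inter> (E \<inter> B0))" "q UNIV = p (E \<inter> B0)"
     "\<And>B. B \<in> F \<Longrightarrow> q B = p (B \<inter> (E \<inter> B0))"
    using insert.IH[OF E(3) EB(1)] by blast
  obtain r where r: "r \<in> atomic" "\<And>A. r A = r (A \<inter> (E - B0))" "r UNIV = p (E - B0)"
     "\<And>B. B \<in> F \<Longrightarrow> r B = p (B \<inter> (E - B0))"
    using insert.IH[OF E(3) EB(2)] by blast
  interpret q: fin_add UNIV q by (rule atomic_fin_add) fact
  interpret r: fin_add UNIV r by (rule atomic_fin_add) fact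
  show ?case
  proof (intro bexI[of _ "\<lambda>A. q A + r A"] conjI allI ballI)
    fix A
    have "A \<inter> E \<inter> (E \<inter> B0) = A \<inter> (E \<inter> B0)" "A \<inter> E \<inter> (E - B0) = A \<inter> (E - B0)" by auto
    then have "q (A \<inter> E) = q A" "r (A \<inter> E) = r A"
      using q(2)[of A] q(2)[of "A \<inter> E"] r(2)[of A] r(2)[of "A \<inter> E"] by simp_all
    then show "q A + r A = q (A \<inter> E) + r (A \<inter> E)" by simp
  next
    show "q UNIV + r UNIV = p E" using q(3) r(3) split[OF E(1,2)] by simp
  next
    fix B assume "B \<in> insert B0 F"
    then consider "B = B0" | "B \<in> F" by auto
    then show "q B + r B = p (B \<inter> E)"
    proof cases
      case 1
      have "B0 \<inter> (E \<inter> B0) = UNIV \<inter> (E \<inter> B0)" "B0 \<inter> (E - B0) = {}" by auto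
      then have "q B0 = q UNIV" "r B0 = 0" using q(2)[of B0] q(2)[of UNIV] r(2)[of B0] r.p_empty by metis+
      then show ?thesis using q(3) 1 by (simp add: Int_commute)
    next
      case 2
      then have "B \<in> M" using insert.prems by auto
      then have "p (B \<inter> E) = p (B \<inter> E \<inter> B0) + p (B \<inter> E - B0)" using split[of "B \<inter> E" B0] E by auto
      then show ?thesis using q(4)[OF 2] r(4)[OF 2] by (simp add: Int_assoc Int_Diff)
    qed
  qed (rule atomic_add[OF q(1) r(1)])
qed

text \<open>
  The algebra \<open>W\<close> is the algebraic counterpart of the sets that split no point (of \<open>p\<close>-positive
  measure) lying in infinitely many \<open>S j\<close>; the last claim is what makes it survive the recursion.
\<close>

lemma decided_algebra:
  assumes N: "algebra UNIV N" "N \<subseteq> M" and S: "\<And>j::nat. S j \<in> M"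
  defines "W \<equiv> {A\<in>M. \<forall>e>0. \<exists>B\<in>N. \<exists>B'\<in>N. B \<subseteq> A \<and> B' \<inter> A = {} \<and>
                     (\<exists>j0. \<forall>j\<ge>j0. p (S j - (B \<union> B')) \<le> e)}"
  shows "algebra UNIV W" "N \<subseteq> W"
    and "\<And>A m. A \<in> M \<Longrightarrow> (\<And>j. j \<ge> m \<Longrightarrow> S j \<in> N) \<Longrightarrow> (\<And>j. j \<ge> m \<Longrightarrow> A \<inter> S j \<in> W) \<Longrightarrow> A \<in> W"
proof -
  interpret N: algebra UNIV N by fact
  show NW: "N \<subseteq> W"
  proof
    fix A assume "A \<in> N"
    have "p (S j - (A \<union> - A)) \<le> e" if "e > 0" for j e using that p_empty by (simp add: Diff_eq)
    moreover have "- A \<in> N" "A \<subseteq> A" "- A \<inter> A = {}" using algebra_UNIV_compl[OF N(1) \<open>A \<in> N\<close>] by auto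
    ultimately have "\<exists>B\<in>N. \<exists>B'\<in>N. B \<subseteq> A \<and> B' \<inter> A = {} \<and> (\<exists>j0. \<forall>j\<ge>j0. p (S j - (B \<union> B')) \<le> e)" if "e > 0" for e
      using that \<open>A \<in> N\<close> by meson
    then show "A \<in> W" using \<open>A \<in> N\<close> N unfolding W_def by auto
  qed
  show alg: "algebra UNIV W"
  proof (rule algebra_UNIV_I)
    show "{} \<in> W" using NW by auto
  next
    fix A assume A: "A \<in> W"
    have "\<exists>B\<in>N. \<exists>B'\<in>N. B \<subseteq> - A \<and> B' \<inter> - A = {} \<and> (\<exists>j0. \<forall>j\<ge>j0. p (S j - (B \<union> B')) \<le> e)" if "e > 0" for e
    proof -
      obtain B B' where "B\<in>N" "B'\<in>N" "B \<subseteq> A \<and> B' \<inter> A = {} \<and> (\<exists>j0. \<forall>j\<ge>j0. p (S j - (B \<union> B')) \<le> e)"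
        using A \<open>e > 0\<close> unfolding W_def by blast
      moreover from this have "B' \<subseteq> - A" "B \<inter> - A = {}" by auto
      ultimately show ?thesis by (metis Un_commute)
    qed
    then show "- A \<in> W" using A compl_closed unfolding W_def by auto
  next
    fix A1 A2 assume A: "A1 \<in> W" "A2 \<in> W"
    have "\<exists>B\<in>N. \<exists>B'\<in>N. B \<subseteq> A1 \<inter> A2 \<and> B' \<inter> (A1 \<inter> A2) = {} \<and> (\<exists>j0. \<forall>j\<ge>j0. p (S j - (B \<union> B')) \<le> e)" if "e > 0" for e
    proof -
      obtain B1 B1' j1 where 1: "B1\<in>N" "B1'\<in>N" "B1 \<subseteq> A1" "B1' \<inter> A1 = {}" "\<And>j. j\<ge>j1 \<Longrightarrow> p (S j - (B1 \<union> B1')) \<le> e/2"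
        using A(1) half_gt_zero[OF \<open>e > 0\<close>] unfolding W_def by blast
      obtain B2 B2' j2 where 2: "B2\<in>N" "B2'\<in>N" "B2 \<subseteq> A2" "B2' \<inter> A2 = {}" "\<And>j. j\<ge>j2 \<Longrightarrow> p (S j - (B2 \<union> B2')) \<le> e/2"
        using A(2) half_gt_zero[OF \<open>e > 0\<close>] unfolding W_def by blast
      have "p (S j - (B1 \<inter> B2 \<union> (B1' \<union> B2'))) \<le> e" if "j \<ge> max j1 j2" for j
      proof -
        have M: "B1 \<in> M" "B2 \<in> M" "B1' \<in> M" "B2' \<in> M" using 1 2 N by auto
        have "p (S j - (B1 \<inter> B2 \<union> (B1' \<union> B2'))) \<le> p ((S j - (B1 \<union> B1')) \<union> (S j - (B2 \<union> B2')))"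
          using M S by (intro mono) auto
        also have "\<dots> \<le> p (S j - (B1 \<union> B1')) + p (S j - (B2 \<union> B2'))"
          using M S by (intro subadd) auto
        also have "\<dots> \<le> e/2 + e/2" using 1(5)[of j] 2(5)[of j] that by (intro add_mono) auto
        finally show ?thesis by simp
      qed
      moreover have "B1 \<inter> B2 \<in> N" "B1' \<union> B2' \<in> N" using 1(1,2) 2(1,2) by auto
      moreover have "B1 \<inter> B2 \<subseteq> A1 \<inter> A2" "(B1' \<union> B2') \<inter> (A1 \<inter> A2) = {}"
        using 1(3,4) 2(3,4) by blast+
      ultimately show ?thesis by meson
    qed
    then show "A1 \<inter> A2 \<in> W" using A unfolding W_def by auto
  qed
  fix A m assume A: "A \<in> M" "\<And>j. j \<ge> m \<Longrightarrow> S j \<in> N" "\<And>j. j \<ge> m \<Longrightarrow> A \<inter> S j \<in> W"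
  interpret W: algebra UNIV W by fact
  \<comment> \<open>The unions \<open>G i\<close> increase and \<open>p (G i)\<close> is bounded, so
    for late \<open>i\<close> no later \<open>S j\<close> has much \<open>p\<close>-mass outside
    \<open>G i\<close>; finite additivity suffices for this.\<close>
  define G where "G = (\<lambda>i. \<Union>l\<in>{m..i}. S l)"
  have GN: "G i \<in> N" for i unfolding G_def using A by (intro N.finite_UN) auto
  have GM: "G i \<in> M" for i using GN N by auto
  have "incseq (\<lambda>i. p (G i))"
    by (intro incseq_SucI mono GM, unfold G_def) (intro UN_mono, auto)
  moreover have "p (G i) \<le> p UNIV" for i by (rule mono[OF GM]) auto
  ultimately obtain L where "(\<lambda>i. p (G i)) \<longlonglongrightarrow> L" using incseq_convergent by blast
  then have "convergent (\<lambda>i. p (G i))" by (auto simp: convergent_def)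
  then have Cau: "Cauchy (\<lambda>i. p (G i))" by (rule convergent_Cauchy)
  have "\<exists>B\<in>N. \<exists>B'\<in>N. B \<subseteq> A \<and> B' \<inter> A = {} \<and> (\<exists>j0. \<forall>j\<ge>j0. p (S j - (B \<union> B')) \<le> e)" if "e > 0" for e
  proof -
    obtain i0 where i0: "\<And>i j. i \<ge> i0 \<Longrightarrow> j \<ge> i0 \<Longrightarrow> \<bar>p (G i) - p (G j)\<bar> < e/2"
      using Cau half_gt_zero[OF \<open>e > 0\<close>] unfolding Cauchy_def dist_real_def by blast
    define i where "i = max i0 m"
    have SG: "p (S j - G i) \<le> e/2" if "j \<ge> i" for j
    proof -
      have "p (S j - G i) \<le> p (G j - G i)"
        using S GM that by (intro mono Diff Diff_mono order_refl) (auto simp: G_def i_def)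
      also have "\<dots> = p (G j) - p (G i)"
        using that by (intro diff GM, unfold G_def) (intro UN_mono, auto)
      also have "\<dots> \<le> e/2"
      proof -
        have "j \<ge> i0" "i \<ge> i0" using that by (auto simp: i_def)
        then show ?thesis using i0[of j i] by linarith
      qed
      finally show ?thesis .
    qed
    have "A \<inter> G i = (\<Union>l\<in>{m..i}. A \<inter> S l)" by (auto simp: G_def)
    also have "\<dots> \<in> W" using A by (intro W.finite_UN) auto
    finally have "A \<inter> G i \<in> W" .
    then obtain B B' j1 where B: "B\<in>N" "B'\<in>N" "B \<subseteq> A \<inter> G i" "B' \<inter> (A \<inter> G i) = {}"
        "\<And>j. j\<ge>j1 \<Longrightarrow> p (S j - (B \<union> B')) \<le> e/2"
        using half_gt_zero[OF \<open>e > 0\<close>] unfolding W_def by blast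
    have M: "B \<in> M" "B' \<in> M" using B N by auto
    \<comment> \<open>\<open>B'\<close> avoids only \<open>A \<inter> G i\<close>. Cutting it down
      to \<open>G i\<close> makes it disjoint from \<open>A\<close>, at the cost of
      \<open>p (S j - G i)\<close>.\<close>
    have "p (S j - (B \<union> (B' \<inter> G i))) \<le> e" if "j \<ge> max j1 i" for j
    proof -
      have "p (S j - (B \<union> (B' \<inter> G i))) \<le> p ((S j - (B \<union> B')) \<union> (S j - G i))"
        by (rule mono) (intro Diff Un Int M S GM | blast)+
      also have "\<dots> \<le> p (S j - (B \<union> B')) + p (S j - G i)"
        by (intro subadd Diff Un M S GM)
      also have "\<dots> \<le> e/2 + e/2" using B(5)[of j] SG[of j] that by (intro add_mono) auto
      finally show ?thesis by simp
    qed
    moreover have "B' \<inter> G i \<in> N" "B \<subseteq> A" "(B' \<inter> G i) \<inter> A = {}" using B(2-4) GN by auto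
    ultimately show ?thesis using B(1) by meson
  qed
  then show "A \<in> W" using A(1) unfolding W_def by auto
qed

end

section \<open>Hahn and Lebesgue decompositions up to an error\<close>

text \<open>\<open>B\<close> nearly maximises \<open>p - t * u\<close>: deleting a part of
  \<open>B\<close>, or adding a set disjoint from it, gains at most \<open>e\<close>.\<close>

lemma hahn_approx:
  assumes "fin_add M p" "fin_add M u" "0 \<le> t" "0 < e"
  shows "\<exists>B\<in>M. \<forall>A\<in>M. (A \<subseteq> B \<longrightarrow> t * u A - e \<le> p A) \<and> (A \<inter> B = {} \<longrightarrow> p A \<le> t * u A + e)"
proof -
  interpret p: fin_add M p by fact
  interpret u: fin_add M u by fact
  define g where "g = (\<lambda>B. p B - t * u B)"
  have bdd: "bdd_above (g ` M)"
  proof (rule bdd_aboveI2)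
    fix B assume "B \<in> M"
    then show "g B \<le> p UNIV" using p.mono[of B UNIV] u.nonneg[of B] assms(3)
      by (auto simp: g_def intro: order_trans[of _ "p B"])
  qed
  have "Sup (g ` M) - e < Sup (g ` M)" using assms by simp
  then obtain B where B: "B \<in> M" "Sup (g ` M) - e < g B"
    using less_cSup_iff[OF _ bdd] by (metis (no_types, lifting) empty_is_image equals0D image_iff p.top)
  have up: "g C \<le> g B + e" if "C \<in> M" for C
    using cSup_upper[OF imageI[OF that] bdd] B by simp
  show ?thesis
  proof (intro bexI[of _ B] ballI conjI impI)
    fix A assume A: "A \<in> M" "A \<subseteq> B"
    have "g (B - A) = g B - g A" using A B by (simp add: g_def p.diff u.diff algebra_simps)
    then show "t * u A - e \<le> p A" using up[of "B - A"] p.Diff[of B A] A B(1) by (simp add: g_def)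
  next
    fix A assume A: "A \<in> M" "A \<inter> B = {}"
    have "g (A \<union> B) = g B + g A" using A B by (simp add: g_def p.add u.add algebra_simps)
    then show "p A \<le> t * u A + e" using up[of "A \<union> B"] p.Un[of A B] A B(1) by (simp add: g_def)
  qed (rule B)
qed

text \<open>
  Lebesgue decomposition and Radon--Nikodym up to an error: the cells \<open>C i\<close> are cut out by
  approximate Hahn sets of \<open>p - t u\<close> for \<open>t = d, 2d, \<dots>\<close>, and \<open>S\<close> is where the density is huge.
\<close>

lemma lebesgue_approx:
  assumes "fin_add M p" "fin_add M u" "p UNIV = 1" "u UNIV = 1" "0 < e"
  shows "\<exists>S\<in>M. \<exists>(N::nat) C a. u S \<le> e \<and> (\<forall>i<N. C i \<in> M \<and> 0 \<le> a i) \<and>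
     (\<forall>A\<in>M. \<bar>p (A - S) - (\<Sum>i<N. a i * u (A \<inter> C i))\<bar> \<le> e)"
proof -
  interpret p: fin_add M p by fact
  interpret u: fin_add M u by fact
  \<comment> \<open>\<open>d\<close> is the mesh of density values and \<open>h\<close> the Hahn
    error: over \<open>N\<close> cells they cost at most \<open>d + N * h \<le> e\<close>, while the
    size of \<open>N\<close> gives \<open>u (I N) \<le> 2 / (N * d) \<le> e\<close>.\<close>
  define d where "d = e/2"
  have d: "d > 0" using assms by (simp add: d_def)
  obtain N :: nat where N: "real N > 2 / (d * e)" using reals_Archimedean2 by blast
  have N0: "real N > 0" using N d assms by (smt (verit) divide_nonneg_pos mult_pos_pos)
  define h where "h = min 1 (e / (2 * real N))"
  have h: "0 < h" "h \<le> 1" "real N * h \<le> e/2"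
    using N0 assms by (auto simp: h_def min_def field_simps)
  \<comment> \<open>Forcing \<open>B 0 = UNIV\<close> makes the cells start from the whole
    space.\<close>
  have "\<exists>B\<in>M. (i = 0 \<longrightarrow> B = UNIV) \<and> (\<forall>A\<in>M. (A \<subseteq> B \<longrightarrow> (i*d) * u A - h \<le> p A) \<and> (A \<inter> B = {} \<longrightarrow> p A \<le> (i*d) * u A + h))" for i :: nat
  proof (cases "i = 0")
    case True
    then show ?thesis using h p.nonneg p.p_empty
      by (intro bexI[of _ UNIV]) (auto intro: order_trans[of _ 0])
  next
    case False
    then show ?thesis using hahn_approx[OF assms(1,2), of "i*d" h] d h by auto
  qed
  then obtain B where B: "\<And>i. B i \<in> M" "B 0 = UNIV"
      "\<And>i A. A \<in> M \<Longrightarrow> A \<subseteq> B i \<Longrightarrow> (real i*d) * u A - h \<le> p A"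
      "\<And>i A. A \<in> M \<Longrightarrow> A \<inter> B i = {} \<Longrightarrow> p A \<le> (real i*d) * u A + h"
    by metis
  \<comment> \<open>The sets \<open>B l\<close> may fail to decrease in \<open>l\<close>, but their
    intersections do. \<open>C i\<close> still lies inside \<open>B i\<close> and off
    \<open>B (Suc i)\<close>, which gives both density bounds on it.\<close>
  define I where "I = (\<lambda>i. \<Inter>l\<in>{..i}. B l)"
  have IM: "I i \<in> M" for i unfolding I_def using B by (intro p.finite_INT) auto
  have I0: "I 0 = UNIV" using B by (simp add: I_def)
  have ISuc: "I (Suc i) = I i \<inter> B (Suc i)" for i by (auto simp: I_def atMost_Suc)
  define C where "C = (\<lambda>i. I i - I (Suc i))"
  have CM: "C i \<in> M" for i using IM by (auto simp: C_def)
  have tele: "fin_add M q \<Longrightarrow> A \<in> M \<Longrightarrow> q (A - I n) = (\<Sum>i<n. q (A \<inter> C i))" for q A n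
  proof (induction n)
    case 0
    then show ?case by (simp add: I0 fin_add.p_empty)
  next
    case (Suc n)
    interpret q: fin_add M q by fact
    have "A - I (Suc n) = (A - I n) \<union> (A \<inter> C n)" by (auto simp: C_def ISuc)
    moreover have "q ((A - I n) \<union> (A \<inter> C n)) = q (A - I n) + q (A \<inter> C n)"
      using Suc.prems IM CM by (intro q.add) (auto simp: C_def)
    ultimately show ?case using Suc by simp
  qed
  have cell: "\<bar>p (A \<inter> C i) - real i * d * u (A \<inter> C i)\<bar> \<le> d * u (A \<inter> C i) + h" if "A \<in> M" for A i
  proof -
    have M: "A \<inter> C i \<in> M" using that CM by auto
    have "real i * d * u (A \<inter> C i) - h \<le> p (A \<inter> C i)"
      using B(3)[OF M, of i] by (auto simp: C_def I_def)
    moreover have "p (A \<inter> C i) \<le> (Suc i * d) * u (A \<inter> C i) + h"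
      using B(4)[OF M, of "Suc i"] by (auto simp: C_def ISuc)
    moreover have "0 \<le> d * u (A \<inter> C i)" using d u.nonneg[OF M] by simp
    ultimately show ?thesis by (simp add: algebra_simps abs_le_iff)
  qed
  show ?thesis
  proof (intro bexI[of _ "I N"] exI[of _ N] exI[of _ C] exI[of _ "\<lambda>i. real i * d"] conjI ballI allI impI)
    have "real N * d * u (I N) - h \<le> p (I N)" using B(3)[OF IM, of N N] by (auto simp: I_def)
    also have "\<dots> \<le> 1" using p.mono[OF IM, of UNIV N] assms by auto
    finally have "real N * d * u (I N) \<le> 2" using h by simp
    then have *: "u (I N) \<le> 2 / (real N * d)" using N0 d by (simp add: field_simps)
    have "2 / (real N * d) \<le> e" using N N0 d assms by (simp add: field_simps)
    with * show "u (I N) \<le> e" by linarith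
  next
    fix A assume A: "A \<in> M"
    have "\<bar>p (A - I N) - (\<Sum>i<N. real i * d * u (A \<inter> C i))\<bar> = \<bar>\<Sum>i<N. p (A \<inter> C i) - real i * d * u (A \<inter> C i)\<bar>"
      using tele[OF assms(1) A] by (simp add: sum_subtractf)
    also have "\<dots> \<le> (\<Sum>i<N. d * u (A \<inter> C i) + h)"
      by (rule order_trans[OF sum_abs sum_mono]) (rule cell[OF A])
    also have "\<dots> = d * u (A - I N) + real N * h"
      using tele[OF assms(2) A] by (simp add: sum.distrib sum_distrib_left)
    also have "\<dots> \<le> d * 1 + e/2"
      using h d u.mono[of "A - I N" UNIV] A IM assms by (intro add_mono mult_left_mono) auto
    finally show "\<bar>p (A - I N) - (\<Sum>i<N. real i * d * u (A \<inter> C i))\<bar> \<le> e" by (simp add: d_def)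
  qed (use IM CM d in auto)
qed

section \<open>Densities on layers of dyadic integers\<close>

definition avg :: "nat \<Rightarrow> nat \<Rightarrow> (nat \<times> nat) set \<Rightarrow> real" where
  "avg n k A = (\<Sum>y<2^k. indicator A (n, y)) / 2^k"

definition per :: "(nat \<times> nat) set set" where
  "per = {A. \<forall>n. \<exists>K. \<forall>k\<ge>K. \<forall>y. (n, y) \<in> A \<longleftrightarrow> (n, y mod 2^k) \<in> A}"

text \<open>
  For sets in \<open>per\<close>, whose sections are periodic modulo a power of two, the averages are eventually
  constant in \<open>k\<close>.
\<close>

definition lam :: "nat \<Rightarrow> (nat \<times> nat) set \<Rightarrow> real" where
  "lam n A = lim (\<lambda>k. avg n k A)"

text \<open>
  Meaningful only on sets whose densities converge; elsewhere \<^const>\<open>lim\<close> is an unspecified value.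
\<close>

definition mu :: "(nat \<times> nat) set \<Rightarrow> real" where
  "mu A = lim (\<lambda>n. lam n A)"

definition cyl :: "nat \<Rightarrow> nat \<Rightarrow> (nat \<times> nat) set" where
  "cyl K r = {(n, y). y mod 2^K = r}"

definition tail :: "nat \<Rightarrow> (nat \<times> nat) set" where
  "tail m = {(n, y). m \<le> n}"

text \<open>Cylinders cover finitely many points of the space by sets of small density in every
  layer; tails let later sets avoid any finite number of layers.\<close>

definition gens :: "(nat \<times> nat) set set" where
  "gens = range (\<lambda>(K, r). cyl K r) \<union> range tail"

lemma countable_gens: "countable gens"
  by (simp add: gens_def)

lemma algebra_per: "algebra UNIV per"
proof (rule algebra_UNIV_I)
  fix A B assume A: "A \<in> per" and B: "B \<in> per"
  show "A \<inter> B \<in> per"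
    unfolding per_def
  proof (intro CollectI allI)
    fix n
    from A B obtain K L where "\<forall>k\<ge>K. \<forall>y. (n, y) \<in> A \<longleftrightarrow> (n, y mod 2^k) \<in> A"
      "\<forall>k\<ge>L. \<forall>y. (n, y) \<in> B \<longleftrightarrow> (n, y mod 2^k) \<in> B" unfolding per_def by blast
    then have "(n, y) \<in> A \<inter> B \<longleftrightarrow> (n, y mod 2^k) \<in> A \<inter> B" if "k \<ge> max K L" for k y
      using that by (metis Int_iff max.boundedE)
    then show "\<exists>K. \<forall>k\<ge>K. \<forall>y. (n, y) \<in> A \<inter> B \<longleftrightarrow> (n, y mod 2^k) \<in> A \<inter> B" by blast
  qed
qed (unfold per_def, blast+)

text \<open>Shifting \<open>y\<close> by \<open>2^k\<close> does not change membership, so the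
  second half of the sum repeats the first.\<close>

lemma avg_Suc:
  assumes "\<And>y. (n, y) \<in> A \<longleftrightarrow> (n, y mod 2^k) \<in> A"
  shows "avg n (Suc k) A = avg n k A"
proof -
  have ind: "indicator A (n, y + 2^k) = (indicator A (n, y) :: real)" for y
    using assms[of y] assms[of "y + 2^k"] unfolding indicator_def mod_add_self2 by presburger
  have "(\<Sum>y<2^Suc k. indicator A (n, y)::real) = (\<Sum>y\<in>{0..<2^k+2^k}. indicator A (n, y))"
    by (simp add: lessThan_atLeast0 mult_2)
  also have "\<dots> = (\<Sum>y\<in>{0..<2^k}. indicator A (n, y)) + (\<Sum>y\<in>{2^k..<2^k+2^k}. indicator A (n, y))"
    by (simp add: sum.atLeastLessThan_concat)
  also have "(\<Sum>y\<in>{2^k..<2^k+2^k}. indicator A (n, y)) = (\<Sum>y\<in>{0..<2^k}. indicator A (n, y + 2^k)::real)"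
    using sum.shift_bounds_nat_ivl[of "\<lambda>y. indicator A (n,y)::real" 0 "2^k" "2^k"] by simp
  also have "\<dots> = (\<Sum>y\<in>{0..<2^k}. indicator A (n, y)::real)" by (simp add: ind)
  finally have "(\<Sum>y<2^Suc k. indicator A (n, y)::real) = 2 * (\<Sum>y<2^k. indicator A (n, y))"
    unfolding lessThan_atLeast0 mult_2 .
  then show ?thesis unfolding avg_def by (simp only: power_Suc mult_divide_mult_cancel_left_if) simp
qed

lemma avg_const:
  assumes "\<forall>k\<ge>K. \<forall>y. (n, y) \<in> A \<longleftrightarrow> (n, y mod 2^k) \<in> A" "k \<ge> K"
  shows "avg n k A = avg n K A"
  using assms(2)
proof (induction rule: dec_induct)
  case (step k)
  then show ?case using avg_Suc[of n A k] assms(1) by metis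
qed simp

lemma lam_eq_avg:
  assumes "\<forall>k\<ge>K. \<forall>y. (n, y) \<in> A \<longleftrightarrow> (n, y mod 2^k) \<in> A"
  shows "lam n A = avg n K A" "(\<lambda>k. avg n k A) \<longlonglongrightarrow> lam n A"
proof -
  have "(\<lambda>k. avg n k A) \<longlonglongrightarrow> avg n K A"
    using avg_const[OF assms] by (intro tendsto_eventually eventually_sequentiallyI) blast
  then show "lam n A = avg n K A" "(\<lambda>k. avg n k A) \<longlonglongrightarrow> lam n A"
    unfolding lam_def using limI by metis+
qed

lemma avg_tendsto_lam: "A \<in> per \<Longrightarrow> (\<lambda>k. avg n k A) \<longlonglongrightarrow> lam n A"
  using lam_eq_avg(2) unfolding per_def by blast

lemma avg_atomic: "avg n k \<in> atomic"
proof -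
  have "(\<lambda>A. \<Sum>y<(2::nat)^k. (1/2^k) * indicator A (n, y)) \<in> atomic"
    by (intro atomic_sum atomic_point) auto
  also have "(\<lambda>A. \<Sum>y<(2::nat)^k. (1/2^k) * indicator A (n, y)) = avg n k"
    by (auto simp: avg_def sum_divide_distrib)
  finally show ?thesis .
qed

lemma fin_add_limit:
  assumes "algebra UNIV M" "\<And>k. fin_add M (q k)" "\<And>A. A \<in> M \<Longrightarrow> (\<lambda>k. q k A) \<longlonglongrightarrow> p A"
  shows "fin_add M p"
proof -
  interpret algebra UNIV M by fact
  show ?thesis
  proof
    fix A assume "A \<in> M"
    then show "0 \<le> p A"
      by (intro LIMSEQ_le_const[OF assms(3)]) (auto intro!: fin_add.nonneg[OF assms(2)])
  next
    fix A B assume AB: "A \<in> M" "B \<in> M" "A \<inter> B = {}"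
    have "(\<lambda>k. q k (A \<union> B)) \<longlonglongrightarrow> p A + p B"
      unfolding fin_add.add[OF assms(2) AB]
      by (rule tendsto_add[OF assms(3)[OF AB(1)] assms(3)[OF AB(2)]])
    then show "p (A \<union> B) = p A + p B"
      using LIMSEQ_unique[OF assms(3)[of "A \<union> B"]] AB by blast
  qed
qed

lemma fin_add_lam: "fin_add per (lam n)"
  by (rule fin_add_limit[OF algebra_per _ avg_tendsto_lam])
     (auto intro: fin_add.subalgebra[OF atomic_fin_add[OF avg_atomic] algebra_per])

lemma lam_UNIV: "lam n UNIV = 1"
  using lam_eq_avg(1)[of 0 n UNIV] by (simp add: avg_def)

text \<open>Only an inequality, because a residue \<open>r \<ge> 2^K\<close> gives the empty
  set.\<close>

lemma lam_cyl_le: "lam n (cyl K r) \<le> (1/2)^K"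
proof -
  have "lam n (cyl K r) = avg n K (cyl K r)"
  proof (rule lam_eq_avg, intro allI impI)
    fix k y assume "K \<le> k"
    then have "(2::nat)^K dvd 2^k" by (rule le_imp_power_dvd)
    then show "(n, y) \<in> cyl K r \<longleftrightarrow> (n, y mod 2^k) \<in> cyl K r" by (simp add: cyl_def mod_mod_cancel)
  qed
  also have "(\<Sum>y<2^K. indicator (cyl K r) (n, y)::real) = (\<Sum>y<2^K. if y = r then 1 else 0)"
    by (intro sum.cong) (auto simp: cyl_def indicator_def)
  then have "avg n K (cyl K r) \<le> (1/2)^K" by (simp add: avg_def power_divide)
  finally show ?thesis .
qed

lemma gens_per: "balg gens \<subseteq> per"
proof (rule balg_least[OF algebra_per], clarsimp simp: gens_def, intro conjI subsetI)
  fix A assume "A \<in> range (\<lambda>(K, r). cyl K r)"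
  then obtain K r where A: "A = cyl K r" by auto
  show "A \<in> per" unfolding per_def
  proof (intro CollectI allI exI[of _ K] impI)
    fix n k y assume "K \<le> k"
    then have "(2::nat)^K dvd 2^k" by (rule le_imp_power_dvd)
    then show "(n, y) \<in> A \<longleftrightarrow> (n, y mod 2^k) \<in> A" by (simp add: A cyl_def mod_mod_cancel)
  qed
qed (auto simp: per_def tail_def)

text \<open>Cylinders ignore the layer and tails are eventually full. Sets whose sections eventually
  do not depend on the layer form an algebra, and on them \<open>lam n\<close> is eventually
  constant.\<close>

lemma gens_lam_convergent:
  assumes "A \<in> balg gens" shows "convergent (\<lambda>n. lam n A)"
proof -
  define W :: "(nat \<times> nat) set set" where "W = {A. \<exists>m. \<forall>n\<ge>m. \<forall>y. (n, y) \<in> A \<longleftrightarrow> (m, y) \<in> A}"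
  have "algebra UNIV W"
  proof (rule algebra_UNIV_I)
    fix A B assume "A \<in> W" "B \<in> W"
    then obtain m l where "\<forall>n\<ge>m. \<forall>y. (n, y) \<in> A \<longleftrightarrow> (m, y) \<in> A" "\<forall>n\<ge>l. \<forall>y. (n, y) \<in> B \<longleftrightarrow> (l, y) \<in> B"
      by (auto simp: W_def)
    then have "(n, y) \<in> A \<inter> B \<longleftrightarrow> (max m l, y) \<in> A \<inter> B" if "n \<ge> max m l" for n y
      using that by (metis Int_iff max.boundedE max.cobounded1 max.cobounded2)
    then show "A \<inter> B \<in> W" unfolding W_def by blast
  qed (unfold W_def, blast+)
  moreover have "gens \<subseteq> W" by (auto simp: gens_def W_def tail_def cyl_def)
  ultimately have "A \<in> W" using balg_least assms by blast
  then obtain m where m: "\<And>n y. n \<ge> m \<Longrightarrow> (n, y) \<in> A \<longleftrightarrow> (m, y) \<in> A" by (auto simp: W_def)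
  then have "avg n k A = avg m k A" if "n \<ge> m" for n k using m[OF that] unfolding avg_def indicator_def by presburger
  then have "lam n A = lam m A" if "n \<ge> m" for n using that unfolding lam_def by presburger
  then have "(\<lambda>n. lam n A) \<longlonglongrightarrow> lam m A"
    by (intro tendsto_eventually eventually_sequentiallyI)
  then show ?thesis by (auto simp: convergent_def)
qed

lemma mu_fin_add:
  assumes "algebra UNIV N" "N \<subseteq> per" "\<And>B. B \<in> N \<Longrightarrow> convergent (\<lambda>n. lam n B)"
  shows "fin_add N mu" "B \<in> N \<Longrightarrow> (\<lambda>n. lam n B) \<longlonglongrightarrow> mu B" "mu UNIV = 1"
proof -
  show lim: "(\<lambda>n. lam n B) \<longlonglongrightarrow> mu B" if "B \<in> N" for B
    using assms(3)[OF that] by (simp add: mu_def convergent_LIMSEQ_iff)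
  show "fin_add N mu"
    by (rule fin_add_limit[OF assms(1) fin_add.subalgebra[OF fin_add_lam assms(1,2)] lim])
  show "mu UNIV = 1" by (simp add: mu_def lam_UNIV)
qed

section \<open>The set that kills one sequence of measures\<close>

lemma sum_half_powers: "(\<Sum>j\<in>{a..<b}. (1/2)^j) \<le> (2::real) * (1/2)^a"
proof (cases "a \<le> b")
  case True
  have "(\<Sum>j\<in>{a..<b}. (1/2)^j) = (2::real) * (1/2)^a - 2 * (1/2)^b"
    using True by (induction rule: dec_induct) auto
  then show ?thesis by simp
qed auto

text \<open>
  The new set is \<open>\<Union>m. F (k m) (l m)\<close>, where the \<open>m\<close>-th piece avoids the first \<open>m\<close> layers and
  the sets \<open>S i j\<close> with \<open>i < m\<close>, \<open>i + 4 \<le> j < m\<close>. These excluded sets have total \<open>mu\<close>-measure at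
  most \<open>1/4\<close>, so that the hypothesis on \<open>F\<close> applies to what remains.
\<close>

lemma killing_step:
  assumes alg: "algebra UNIV N" and per: "N \<subseteq> per"
    and conv: "\<And>B. B \<in> N \<Longrightarrow> convergent (\<lambda>n. lam n B)"
    and tail: "\<And>m. tail m \<in> N"
    and cnt: "countable \<C>"
    and com: "\<And>S j. S \<in> \<C> \<Longrightarrow> S j \<in> N \<and> mu (S j) \<le> (1/2)^j"
    and F: "\<And>k l. F k l \<in> N"
    and H: "\<And>V m. V \<in> N \<Longrightarrow> mu V > 1/2 \<Longrightarrow> \<exists>k\<ge>m. \<exists>l. F k l \<subseteq> V \<and> (\<forall>n. lam n (F k l) \<le> (1/2)^m)"
  shows "\<exists>a\<in>per. (\<forall>B\<in>N. convergent (\<lambda>n. lam n (a \<inter> B))) \<and> (\<forall>S\<in>\<C>. \<exists>m. \<forall>j\<ge>m. a \<inter> S j \<in> N)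
      \<and> mu a \<le> 1/4 \<and> (\<forall>m::nat. \<exists>k\<ge>m. \<exists>l::nat. F k l \<subseteq> a)"
proof -
  interpret algebra UNIV N by fact
  interpret mu: fin_add N mu by (rule mu_fin_add[OF alg per conv])
  \<comment> \<open>The commitments are enumerated together with the constant empty sequence, so
    that an enumeration exists even for empty \<open>\<C>\<close>.\<close>
  obtain S :: "nat \<Rightarrow> nat \<Rightarrow> (nat \<times> nat) set" where S: "\<C> \<subseteq> range S" "\<And>i j. S i j \<in> N" "\<And>i j. mu (S i j) \<le> (1/2)^j"
  proof -
    have ne: "insert (\<lambda>_. {}) \<C> \<noteq> {}" and ct: "countable (insert (\<lambda>_. {}) \<C>)" using cnt by auto
    have r: "range (from_nat_into (insert (\<lambda>_. {}) \<C>)) = insert (\<lambda>_. {}) \<C>"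
      by (rule range_from_nat_into[OF ne ct])
    show ?thesis
    proof (rule that[of "from_nat_into (insert (\<lambda>_. {}) \<C>)"])
      fix i j
      have "from_nat_into (insert (\<lambda>_. {}) \<C>) i \<in> insert (\<lambda>_. {}) \<C>" by (rule from_nat_into[OF ne])
      then show "from_nat_into (insert (\<lambda>_. {}) \<C>) i j \<in> N" "mu (from_nat_into (insert (\<lambda>_. {}) \<C>) i j) \<le> (1/2)^j"
        using com by (auto simp: mu.p_empty)
    qed (use r in auto)
  qed
  define V where "V = (\<lambda>m. tail m - (\<Union>i\<in>{..<m}. \<Union>j\<in>{i+4..<m}. S i j))"
  have VN: "V m \<in> N" for m unfolding V_def by (intro Diff finite_UN tail S) auto
  have mu_tail: "mu (tail m) = 1" for m
  proof -
    have "lam n (tail m) = 1" if "n \<ge> m" for n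
    proof -
      have "avg n k (tail m) = 1" for k using that by (simp add: avg_def tail_def)
      then show ?thesis by (simp add: lam_def)
    qed
    then have "(\<lambda>n. lam n (tail m)) \<longlonglongrightarrow> 1"
      by (intro tendsto_eventually) (auto simp: eventually_sequentially)
    then show ?thesis by (simp add: mu_def limI)
  qed
  have muV: "mu (V m) > 1/2" for m
  proof -
    let ?U = "\<Union>i\<in>{..<m}. \<Union>j\<in>{i+4..<m}. S i j"
    have U: "?U \<in> N" by (intro finite_UN S) auto
    have "mu ?U \<le> (\<Sum>i\<in>{..<m}. mu (\<Union>j\<in>{i+4..<m}. S i j))"
      by (intro mu.subadd_UN finite_UN S) auto
    also have "\<dots> \<le> (\<Sum>i\<in>{..<m}. \<Sum>j\<in>{i+4..<m}. mu (S i j))"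
      by (intro sum_mono mu.subadd_UN S) auto
    also have "\<dots> \<le> (\<Sum>i\<in>{..<m}. \<Sum>j\<in>{i+4..<m}. (1/2)^j)" by (intro sum_mono S)
    also have "\<dots> \<le> (\<Sum>i\<in>{..<m}. 2 * (1/2)^(i+4))" by (intro sum_mono sum_half_powers)
    also have "\<dots> = (1/8) * (\<Sum>i\<in>{0..<m}. (1/2)^i)"
      by (simp add: sum_distrib_left lessThan_atLeast0 power_add power_divide)
    also have "\<dots> \<le> (1/8) * (2 * (1/2)^0)" by (intro mult_left_mono sum_half_powers) auto
    finally have "mu ?U \<le> 1/4" by simp
    moreover have "mu (tail m) \<le> mu (V m \<union> ?U)"
      by (intro mu.mono tail Un VN U) (auto simp: V_def)
    moreover have "\<dots> \<le> mu (V m) + mu ?U" by (intro mu.subadd VN U)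
    ultimately show ?thesis using mu_tail by simp
  qed
  \<comment> \<open>With exponent \<open>m + 4\<close> the pieces from \<open>M\<close> on have
    density at most \<open>2 * (1/2)^(M+4)\<close> in every layer; for \<open>M = 0\<close> this
    bounds \<open>a\<close> by 1/8.\<close>
  have "\<exists>k\<ge>m+4. \<exists>l. F k l \<subseteq> V m \<and> (\<forall>n. lam n (F k l) \<le> (1/2)^(m+4))" for m
    by (rule H[OF VN muV])
  then obtain k l where kl: "\<And>m. k m \<ge> m + 4" "\<And>m. F (k m) (l m) \<subseteq> V m"
      "\<And>m n. lam n (F (k m) (l m)) \<le> (1/2)^(m+4)"
    by metis
  define A where "A = (\<lambda>m. F (k m) (l m))"
  have AN: "A m \<in> N" for m using F by (simp add: A_def)
  have Atail: "A m \<subseteq> tail m" for m using kl(2)[of m] by (auto simp: A_def V_def)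
  define a where "a = (\<Union>m. A m)"
  define P where "P = (\<lambda>M. \<Union>m\<in>{..<M}. A m)"
  have PN: "P M \<in> N" for M unfolding P_def by (intro finite_UN AN) auto
  \<comment> \<open>\<open>A m\<close> avoids the layers below \<open>m\<close>, so each layer meets
    only finitely many pieces and periodicity is inherited layer by layer.\<close>
  have lay: "(n, y) \<in> a \<longleftrightarrow> (n, y) \<in> P M" if "n < M" for n y M
    using that Atail by (fastforce simp: a_def P_def tail_def)
  have aper: "a \<in> per"
    unfolding per_def
  proof (intro CollectI allI)
    fix n
    have "P (Suc n) \<in> per" using PN per by blast
    then obtain K where "\<forall>k\<ge>K. \<forall>y. (n, y) \<in> P (Suc n) \<longleftrightarrow> (n, y mod 2^k) \<in> P (Suc n)"
      unfolding per_def by blast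
    then show "\<exists>K. \<forall>k\<ge>K. \<forall>y. (n, y) \<in> a \<longleftrightarrow> (n, y mod 2^k) \<in> a" using lay[of n "Suc n", OF lessI] by metis
  qed
  interpret per: algebra UNIV per by (rule algebra_per)
  \<comment> \<open>\<open>lam n\<close> is only finitely additive, so the part beyond layer
    \<open>n\<close>, which it does not see, is removed first; finitely many pieces remain.\<close>
  have lam_tail: "lam n (a - P M) \<le> 2 * (1/2)^(M+4)" for n M
  proof -
    interpret l: fin_add per "lam n" by (rule fin_add_lam)
    have R: "(\<Union>m\<in>{M..<Suc n}. A m) \<in> per" using AN per by (intro per.finite_UN) auto
    have D: "a - P M \<in> per" "tail (Suc n) \<in> per" "a - P M - tail (Suc n) \<in> per"
      using aper PN per tail by (auto intro!: per.Diff)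
    have "avg n k ((a - P M) \<inter> tail (Suc n)) = 0" for k
      by (simp add: avg_def tail_def indicator_def)
    then have "lam n ((a - P M) \<inter> tail (Suc n)) = 0" by (simp add: lam_def)
    then have "lam n (a - P M) = lam n ((a - P M) - tail (Suc n))"
      using l.split[OF D(1,2)] by linarith
    also have "lam n ((a - P M) - tail (Suc n)) \<le> lam n (\<Union>m\<in>{M..<Suc n}. A m)"
    proof (rule l.mono[OF D(3) R])
      show "(a - P M) - tail (Suc n) \<subseteq> (\<Union>m\<in>{M..<Suc n}. A m)"
      proof
        fix x assume x: "x \<in> (a - P M) - tail (Suc n)"
        then obtain m where m: "x \<in> A m" by (auto simp: a_def)
        then have "m \<ge> M" using x unfolding P_def by (metis DiffD1 DiffD2 UN_I lessThan_iff not_less)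
        moreover have "m \<le> n" using m Atail[of m] x by (cases x) (auto simp: tail_def)
        ultimately show "x \<in> (\<Union>m\<in>{M..<Suc n}. A m)" using m by auto
      qed
    qed
    also have "\<dots> \<le> (\<Sum>m\<in>{M..<Suc n}. lam n (A m))" using AN per by (intro l.subadd_UN) auto
    also have "\<dots> \<le> (\<Sum>m\<in>{M..<Suc n}. (1/16) * (1/2)^m)"
    proof (intro sum_mono)
      fix m
      have "(1/2::real)^(m+4) = (1/16) * (1/2)^m" by (simp add: power_add power_divide)
      then show "lam n (A m) \<le> (1/16) * (1/2)^m" using kl(3)[where m=m and n=n] by (simp add: A_def)
    qed
    also have "\<dots> \<le> (1/16) * (2 * (1/2)^M)"
      unfolding sum_distrib_left[symmetric] by (intro mult_left_mono sum_half_powers) auto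
    finally show ?thesis by (simp add: power_add power_divide)
  qed
  \<comment> \<open>\<open>a \<inter> B\<close> differs from the set \<open>P M \<inter> B\<close>
    of \<open>N\<close> by a density small uniformly in \<open>n\<close>, which transfers the Cauchy
    property.\<close>
  have aconv: "convergent (\<lambda>n. lam n (a \<inter> B))" if B: "B \<in> N" for B
  proof (rule Cauchy_convergent, rule metric_CauchyI)
    fix e :: real assume e: "e > 0"
    obtain M where M: "(1/2)^M < e" using real_arch_pow_inv[OF e, of "1/2"] by auto
    have close: "\<bar>lam n (a \<inter> B) - lam n (P M \<inter> B)\<bar> \<le> e/4" for n
    proof -
      interpret l: fin_add per "lam n" by (rule fin_add_lam)
      have m: "a \<in> per" "B \<in> per" "P M \<in> per" using aper B PN per by auto
      have "lam n (a \<inter> B) = lam n (a \<inter> B \<inter> P M) + lam n (a \<inter> B - P M)"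
        using m by (intro l.split) auto
      moreover have "a \<inter> B \<inter> P M = P M \<inter> B" by (auto simp: a_def P_def)
      moreover have "lam n (a \<inter> B - P M) \<le> lam n (a - P M)" using m by (intro l.mono) auto
      moreover have "0 \<le> lam n (a \<inter> B - P M)" using m by (intro l.nonneg) auto
      ultimately show ?thesis using lam_tail[of n M] M by (simp add: power_add power_divide)
    qed
    have "Cauchy (\<lambda>n. lam n (P M \<inter> B))" using conv[of "P M \<inter> B"] PN B by (intro convergent_Cauchy) auto
    then obtain n0 where n0: "\<And>n m. n \<ge> n0 \<Longrightarrow> m \<ge> n0 \<Longrightarrow> \<bar>lam n (P M \<inter> B) - lam m (P M \<inter> B)\<bar> < e/2"
      using e unfolding Cauchy_def dist_real_def by (meson half_gt_zero)
    have "dist (lam n (a \<inter> B)) (lam m (a \<inter> B)) < e" if "n \<ge> n0" "m \<ge> n0" for n m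
      using n0[OF that] close[of n] close[of m] unfolding dist_real_def by linarith
    then show "\<exists>M. \<forall>m\<ge>M. \<forall>n\<ge>M. dist (lam m (a \<inter> B)) (lam n (a \<inter> B)) < e" by blast
  qed
  have "mu a \<le> 1/4"
  proof -
    have "convergent (\<lambda>n. lam n (a \<inter> UNIV))" by (rule aconv) auto
    then have "(\<lambda>n. lam n a) \<longlonglongrightarrow> mu a" by (simp add: mu_def convergent_LIMSEQ_iff)
    moreover have "lam n a \<le> 1/4" for n using lam_tail[of n 0] by (simp add: P_def power_divide)
    ultimately show ?thesis by (intro LIMSEQ_le_const2) auto
  qed
  moreover have "\<exists>m. \<forall>j\<ge>m. a \<inter> T j \<in> N" if T: "T \<in> \<C>" for T
  proof -
    obtain i where i: "T = S i" using T S(1) by auto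
    \<comment> \<open>All pieces after the \<open>j\<close>-th avoid \<open>S i j\<close>, so only
      the finite union \<open>P (Suc j)\<close> meets it.\<close>
    have "a \<inter> S i j \<in> N" if j: "j \<ge> i + 4" for j
    proof -
      have "A m \<inter> S i j = {}" if "m > j" for m
      proof -
        have "i \<in> {..<m}" "j \<in> {i+4..<m}" using j that by auto
        then have "S i j \<subseteq> (\<Union>i\<in>{..<m}. \<Union>j\<in>{i+4..<m}. S i j)" by blast
        then show ?thesis using kl(2)[of m] by (auto simp: A_def V_def)
      qed
      then have "a \<inter> S i j \<subseteq> P (Suc j) \<inter> S i j"
        unfolding a_def P_def by (smt (verit) IntD1 IntD2 IntI UN_E UN_I disjoint_iff lessThan_iff not_less_eq subsetI)
      then have "a \<inter> S i j = P (Suc j) \<inter> S i j" by (auto simp: a_def P_def)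
      then show ?thesis using PN S(2) by auto
    qed
    then show ?thesis unfolding i by blast
  qed
  moreover have "\<exists>k\<ge>m. \<exists>l. F k l \<subseteq> a" for m
    using kl(1)[of m] by (intro exI[of _ "k m"] conjI exI[of _ "l m"]) (auto simp: a_def A_def)
  ultimately show ?thesis using aper aconv by blast
qed

section \<open>The transfinite construction\<close>

text \<open>The extra real makes every task occur at uncountably many indices, hence cofinally in an
  order with countable initial segments.\<close>

lemma surjection_real_data:
  "\<exists>e :: real \<Rightarrow> (nat \<Rightarrow> nat \<Rightarrow> (nat \<times> nat) set) \<times> real. surj e"
proof -
  obtain g :: "nat set \<Rightarrow> real" where g: "bij g"
    using nat_sets_eqpoll_reals by (auto simp: eqpoll_def)
  \<comment> \<open>Tag 0 marks the codes of the double sequence, tag 1 those of the real; zeros pad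
    to a common tuple type.\<close>
  define dec where "dec = (\<lambda>N::nat set. ((\<lambda>i j. {(a, b). to_nat (0::nat, i, j, a, b) \<in> N}) :: nat \<Rightarrow> nat \<Rightarrow> (nat \<times> nat) set,
      g {x. to_nat (1::nat, x, 0::nat, 0::nat, 0::nat) \<in> N}))"
  have "surj dec"
  proof (rule surjI)
    fix p :: "(nat \<Rightarrow> nat \<Rightarrow> (nat \<times> nat) set) \<times> real"
    show "dec ({to_nat (0::nat, i, j, a, b) | i j a b. (a, b) \<in> fst p i j} \<union>
               {to_nat (1::nat, x, 0::nat, 0::nat, 0::nat) | x. x \<in> inv g (snd p)}) = p"
      using bij_is_surj[OF g] by (cases p) (auto simp: dec_def surj_f_inv_f)
  qed
  then have "surj (dec \<circ> inv g)" by (rule comp_surj[OF bij_is_surj[OF bij_imp_bij_inv[OF g]]])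
  then show ?thesis by blast
qed

text \<open>In an initial well-order of the reals, a proper initial segment is not equinumerous with
  the reals, so CH makes it countable.\<close>

lemma CH_order:
  includes cardinal_syntax
  assumes CH
  shows "\<exists>R :: real rel. wf R \<and> trans R \<and> (\<forall>x y. x = y \<or> (x, y) \<in> R \<or> (y, x) \<in> R) \<and>
           (\<forall>x. countable {s. (s, x) \<in> R})"
proof -
  define r where "r = |UNIV :: real set|"
  have co: "Card_order r" unfolding r_def by (rule card_of_Card_order)
  have F: "Field r = UNIV" unfolding r_def by (rule Field_card_of)
  have wo: "Well_order r" unfolding r_def by (rule card_of_Well_order)
  define R where "R = r - Id"
  have wf: "wf R" using wo by (simp add: well_order_on_def R_def)
  have lin: "Linear_order r" using wo by (simp add: well_order_on_def)
  then have tr: "trans r" and asym: "antisym r" and tot: "Total r"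
    by (simp_all add: linear_order_on_def partial_order_on_def preorder_on_def)
  have "trans R" unfolding R_def by (rule trans_diff_Id[OF tr asym])
  moreover have "x = y \<or> (x, y) \<in> R \<or> (y, x) \<in> R" for x y
    using tot F by (auto simp: total_on_def R_def)
  moreover have "countable {s. (s, x) \<in> R}" for x
  proof -
    have eq: "{s. (s, x) \<in> R} = underS r x" by (auto simp: underS_def R_def)
    have less: "|underS r x| <o r" by (rule card_of_underS[OF co]) (simp add: F)
    have "\<not> underS r x \<approx> (UNIV :: real set)"
    proof
      assume "underS r x \<approx> (UNIV :: real set)"
      then have "|underS r x| =o r" by (auto simp: eqpoll_def r_def card_of_ordIso[symmetric])
      then show False using less not_ordLess_ordIso by blast
    qed
    then show ?thesis using assms unfolding CH_def eq by blast
  qed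
  ultimately show ?thesis using wf by blast
qed

section \<open>Stages and the requirements on each new set\<close>

text \<open>Only sets added strictly before \<open>x\<close> enter, so the stage is available when
  \<open>f x\<close> is chosen.\<close>

definition stage :: "real rel \<Rightarrow> (real \<Rightarrow> (nat \<times> nat) set) \<Rightarrow> real \<Rightarrow> (nat \<times> nat) set set" where
  "stage R f x = balg (gens \<union> f ` {s. (s, x) \<in> R})"

text \<open>
  The real \<open>d\<close> codes a task \<open>e d\<close>: row \<open>0\<close> is a sequence of sets to commit to, and row \<open>k + 1\<close>
  lists sets of \<open>\<nu>\<^sub>k\<close>-measure above \<open>1/2\<close> for a sequence \<open>\<nu>\<close> to be kept from converging to \<open>mu\<close>.
\<close>

definition committed :: "real rel \<Rightarrow> (real \<Rightarrow> (nat \<times> nat) set) \<Rightarrow> (real \<Rightarrow> nat \<Rightarrow> nat \<Rightarrow> (nat \<times> nat) set) \<Rightarrow> real \<Rightarrow> bool" where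
  "committed R f e d \<longleftrightarrow> (\<forall>j. e d 0 j \<in> stage R f d \<and> mu (e d 0 j) \<le> (1/2)^j)"

text \<open>The hypothesis of \<open>killing_step\<close>. The same \<open>m\<close> forces late
  indices and small densities.\<close>

definition concentrating :: "(nat \<times> nat) set set \<Rightarrow> (nat \<Rightarrow> nat \<Rightarrow> (nat \<times> nat) set) \<Rightarrow> bool" where
  "concentrating N F \<longleftrightarrow> (\<forall>k l. F k l \<in> N) \<and>
     (\<forall>V\<in>N. mu V > 1/2 \<longrightarrow> (\<forall>m. \<exists>k\<ge>m. \<exists>l. F k l \<subseteq> V \<and> (\<forall>n. lam n (F k l) \<le> (1/2)^m)))"

text \<open>Every clause refers to \<open>f\<close> only strictly below \<open>x\<close>, as
  well-founded choice requires. A commitment made at \<open>x\<close> itself already binds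
  \<open>a\<close>.\<close>

definition extends :: "real rel \<Rightarrow> (real \<Rightarrow> nat \<Rightarrow> nat \<Rightarrow> (nat \<times> nat) set) \<Rightarrow> (real \<Rightarrow> (nat \<times> nat) set) \<Rightarrow> real \<Rightarrow> (nat \<times> nat) set \<Rightarrow> bool" where
  "extends R e f x a \<longleftrightarrow> a \<in> per \<and> (\<forall>B\<in>stage R f x. convergent (\<lambda>n. lam n (a \<inter> B))) \<and>
     (\<forall>d. d = x \<or> (d, x) \<in> R \<longrightarrow> committed R f e d \<longrightarrow> (\<exists>m. \<forall>j\<ge>m. a \<inter> e d 0 j \<in> stage R f x)) \<and>
     (concentrating (stage R f x) (\<lambda>k. e x (Suc k)) \<longrightarrow>
        mu a \<le> 1/4 \<and> (\<forall>m. \<exists>k\<ge>m. \<exists>l. e x (Suc k) l \<subseteq> a))"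

lemma stage_cong:
  assumes "\<And>z. (z, x) \<in> R \<Longrightarrow> f z = g z"
  shows "stage R f x = stage R g x"
proof -
  have "f ` {s. (s, x) \<in> R} = g ` {s. (s, x) \<in> R}" using assms by (intro image_cong) auto
  then show ?thesis by (simp add: stage_def)
qed

lemma algebra_stage: "algebra UNIV (stage R f x)"
  by (simp add: stage_def algebra_balg)

lemma countable_stage: "countable {s. (s, x) \<in> R} \<Longrightarrow> countable (stage R f x)"
  unfolding stage_def by (intro countable_balg countable_Un countable_gens countable_image)

lemma stage_mono: "trans R \<Longrightarrow> (x, y) \<in> R \<Longrightarrow> stage R f x \<subseteq> stage R f y"
  unfolding stage_def by (rule balg_mono) (auto dest: transD)

lemma gens_stage: "balg gens \<subseteq> stage R f x"
  unfolding stage_def by (rule balg_mono) auto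

lemma gen_stage: "(y, x) \<in> R \<Longrightarrow> f y \<in> stage R f x"
  unfolding stage_def by (intro balg.gen) auto

text \<open>The algebras generated by \<open>stage R f y\<close> and \<open>f y\<close> form a chain
  above \<open>balg gens\<close>, so their union over \<open>y\<close> below \<open>x\<close>,
  together with \<open>balg gens\<close>, is already an algebra. This replaces a distinction between
  successor and limit positions.\<close>

lemma stage_cases:
  assumes "trans R" and tot: "\<And>x y. x = y \<or> (x, y) \<in> R \<or> (y, x) \<in> R"
    and "A \<in> stage R f x"
  shows "A \<in> balg gens \<or> (\<exists>y. (y, x) \<in> R \<and> A \<in> balg (insert (f y) (stage R f y)))"
proof -
  define T where "T = (\<lambda>y. balg (insert (f y) (stage R f y)))"
  have Tm: "T y \<subseteq> T z" if "(y, z) \<in> R" for y z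
  proof -
    have "T y \<subseteq> stage R f z" unfolding T_def
      using stage_mono[OF assms(1) that, of f] gen_stage[OF that, of f] by (intro balg_least algebra_stage) auto
    also have "\<dots> \<subseteq> T z" by (auto simp: T_def intro: balg.gen)
    finally show ?thesis .
  qed
  have Tg: "balg gens \<subseteq> T y" for y
    using gens_stage[of R f y] by (auto simp: T_def intro: balg.gen)
  define W where "W = balg gens \<union> (\<Union>y\<in>{y. (y, x) \<in> R}. T y)"
  have TT: "A \<inter> B \<in> T z" "- A \<in> T z" if "A \<in> T z" "B \<in> T z" for A B z
    using that by (auto simp: T_def intro: balg.intros)
  have "algebra UNIV W"
  proof (rule algebra_UNIV_I)
    show "{} \<in> W" by (simp add: W_def balg.empty)
  next
    fix A assume "A \<in> W"
    then show "- A \<in> W" using TT(2) unfolding W_def by (blast intro: balg.compl)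
  next
    fix A B assume AB: "A \<in> W" "B \<in> W"
    show "A \<inter> B \<in> W"
    proof (cases "A \<in> balg gens \<and> B \<in> balg gens")
      case True
      then show ?thesis by (auto simp: W_def intro: balg.inter)
    next
      case False
      then obtain y where "(y, x) \<in> R" "A \<in> T y" "B \<in> T y"
        using AB Tg Tm tot unfolding W_def by (smt (verit) UN_E Un_iff mem_Collect_eq subsetD)
      then show ?thesis using TT(1) unfolding W_def by blast
    qed
  qed
  moreover have "gens \<union> f ` {s. (s, x) \<in> R} \<subseteq> W"
    by (auto simp: W_def T_def intro: balg.gen)
  ultimately have "stage R f x \<subseteq> W" unfolding stage_def by (rule balg_least)
  then show ?thesis using assms(3) by (auto simp: W_def T_def)
qed

text \<open>Outside \<open>balg gens\<close> a set has the form
  \<open>(B \<inter> f y) \<union> (C - f y)\<close> with \<open>B\<close>, \<open>C\<close> from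
  stage \<open>y\<close>. Its density is that of \<open>f y \<inter> B\<close>, plus that of
  \<open>C\<close>, minus that of \<open>f y \<inter> C\<close>, and all three converge.\<close>

lemma stage_lam_convergent:
  assumes "wf R" "trans R" and tot: "\<And>x y. x = y \<or> (x, y) \<in> R \<or> (y, x) \<in> R"
    and "\<And>y. (y, x) \<in> R \<Longrightarrow> f y \<in> per"
    and "\<And>y B. (y, x) \<in> R \<Longrightarrow> B \<in> stage R f y \<Longrightarrow> convergent (\<lambda>n. lam n (f y \<inter> B))"
    and "A \<in> stage R f x"
  shows "A \<in> per \<and> convergent (\<lambda>n. lam n A)"
  using assms(1,4-6)
proof (induction x arbitrary: A rule: wf_induct_rule)
  case (less x)
  from stage_cases[OF assms(2) tot less.prems(3)] show ?case
  proof (elim disjE exE conjE)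
    assume "A \<in> balg gens"
    then show ?thesis using gens_per gens_lam_convergent by blast
  next
    fix y assume y: "(y, x) \<in> R" and A: "A \<in> balg (insert (f y) (stage R f y))"
    obtain B C where BC: "B \<in> stage R f y" "C \<in> stage R f y" "A = (B \<inter> f y) \<union> (C - f y)"
      using balg_insert[OF algebra_stage A] by blast
    have IH: "D \<in> per \<and> convergent (\<lambda>n. lam n D)" if "D \<in> stage R f y" for D
    proof (rule less.IH[OF y _ _ that])
      fix z assume z: "(z, y) \<in> R"
      then have zx: "(z, x) \<in> R" using y assms(2) by (blast dest: transD)
      show "f z \<in> per" by (rule less.prems(1)[OF zx])
      show "convergent (\<lambda>n. lam n (f z \<inter> B))" if "B \<in> stage R f z" for B
        by (rule less.prems(2)[OF zx that])
    qed
    interpret per: algebra UNIV per by (rule algebra_per)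
    have P: "f y \<in> per" "B \<in> per" "C \<in> per" using less.prems(1)[OF y] IH BC by auto
    then have "A \<in> per" unfolding BC(3) by blast
    moreover have "lam n A = lam n (f y \<inter> B) + (lam n C - lam n (f y \<inter> C))" for n
    proof -
      interpret l: fin_add per "lam n" by (rule fin_add_lam)
      have "lam n A = lam n (B \<inter> f y) + lam n (C - f y)"
        unfolding BC(3) using P by (intro l.add) auto
      moreover have "lam n C = lam n (C \<inter> f y) + lam n (C - f y)" by (rule l.split[OF P(3,1)])
      ultimately show ?thesis by (simp add: Int_commute)
    qed
    then have "(\<lambda>n. lam n A) = (\<lambda>n. lam n (f y \<inter> B) + (lam n C - lam n (f y \<inter> C)))" by blast
    moreover have "convergent (\<lambda>n. lam n (f y \<inter> B) + (lam n C - lam n (f y \<inter> C)))"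
      using less.prems(2)[OF y BC(1)] less.prems(2)[OF y BC(2)] IH[OF BC(2)]
      by (intro convergent_add convergent_diff) auto
    ultimately show ?thesis by simp
  qed
qed

text \<open>Initial segments being countable, only countably many commitments bind at
  \<open>x\<close>, which is what \<open>killing_step\<close> allows.\<close>

lemma extension_exists:
  assumes "wf R" "trans R" and tot: "\<And>x y. x = y \<or> (x, y) \<in> R \<or> (y, x) \<in> R"
    and cnt: "countable {s. (s, x) \<in> R}"
    and "\<And>y. (y, x) \<in> R \<Longrightarrow> extends R e f y (f y)"
  shows "\<exists>a. extends R e f x a"
proof -
  let ?N = "stage R f x"
  interpret algebra UNIV ?N by (rule algebra_stage)
  have N: "B \<in> per \<and> convergent (\<lambda>n. lam n B)" if "B \<in> ?N" for B
    by (rule stage_lam_convergent[OF assms(1-3) _ _ that]) (use assms(5) in \<open>auto simp: extends_def\<close>)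
  show ?thesis
  proof (cases "concentrating ?N (\<lambda>k. e x (Suc k))")
    \<comment> \<open>There is nothing to kill, and the empty set respects all commitments.\<close>
    case False
    then have "extends R e f x {}"
      using algebra_per N[OF empty_sets] unfolding extends_def by auto
    then show ?thesis by blast
  next
    case True
    define C where "C = (\<lambda>d. e d 0) ` {d. (d = x \<or> (d, x) \<in> R) \<and> committed R f e d}"
    have "{d. (d = x \<or> (d, x) \<in> R) \<and> committed R f e d} \<subseteq> insert x {s. (s, x) \<in> R}" by auto
    then have cC: "countable C" unfolding C_def
      using cnt by (meson countable_image countable_insert countable_subset)
    have "\<exists>a\<in>per. (\<forall>B\<in>?N. convergent (\<lambda>n. lam n (a \<inter> B))) \<and> (\<forall>S\<in>C. \<exists>m. \<forall>j\<ge>m. a \<inter> S j \<in> ?N)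
      \<and> mu a \<le> 1/4 \<and> (\<forall>m::nat. \<exists>k\<ge>m. \<exists>l::nat. e x (Suc k) l \<subseteq> a)"
    proof (rule killing_step[OF algebra_stage _ _ _ cC])
      show "?N \<subseteq> per" using N by blast
      show "convergent (\<lambda>n. lam n B)" if "B \<in> ?N" for B using N that by blast
      show "tail m \<in> ?N" for m
      proof -
        have "tail m \<in> balg gens" by (intro balg.gen) (simp add: gens_def)
        then show ?thesis using gens_stage by blast
      qed
      show "S j \<in> ?N \<and> mu (S j) \<le> (1/2)^j" if "S \<in> C" for S j
        using that stage_mono[OF assms(2), of _ x f] by (fastforce simp: C_def committed_def)
      show "e x (Suc k) l \<in> ?N" for k l using True by (auto simp: concentrating_def)
      show "\<exists>k\<ge>m. \<exists>l. e x (Suc k) l \<subseteq> V \<and> (\<forall>n. lam n (e x (Suc k) l) \<le> (1/2)^m)"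
        if "V \<in> ?N" "mu V > 1/2" for V m using True that unfolding concentrating_def by blast
    qed
    then obtain a where "a \<in> per" "\<forall>B\<in>?N. convergent (\<lambda>n. lam n (a \<inter> B))"
      "\<forall>S\<in>C. \<exists>m. \<forall>j\<ge>m. a \<inter> S j \<in> ?N" "mu a \<le> 1/4" "\<forall>m::nat. \<exists>k\<ge>m. \<exists>l::nat. e x (Suc k) l \<subseteq> a"
      by blast
    then have "extends R e f x a" unfolding extends_def C_def by auto
    then show ?thesis by blast
  qed
qed

section \<open>The tower of stages and its union algebra\<close>

text \<open>\<open>cofinal\<close> lets a task be posed after all the sets it mentions have been
  built.\<close>

locale tower =
  fixes R :: "real rel" and e :: "real \<Rightarrow> nat \<Rightarrow> nat \<Rightarrow> (nat \<times> nat) set"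
    and f :: "real \<Rightarrow> (nat \<times> nat) set"
  assumes wf: "wf R" and trans: "trans R"
    and tot: "x = y \<or> (x, y) \<in> R \<or> (y, x) \<in> R"
    and countable_below: "countable {s. (s, x) \<in> R}"
    and cofinal: "\<exists>y. (x, y) \<in> R \<and> e y = d"
    and extends: "extends R e f x (f x)"

lemma tower_exists:
  assumes CH
  shows "\<exists>R e f. tower R e f"
proof -
  obtain R :: "real rel" where R: "wf R" "trans R" "\<And>x y. x = y \<or> (x, y) \<in> R \<or> (y, x) \<in> R"
     "\<And>x. countable {s. (s, x) \<in> R}"
    using CH_order[OF assms] by blast
  obtain h :: "real \<Rightarrow> (nat \<Rightarrow> nat \<Rightarrow> (nat \<times> nat) set) \<times> real" where h: "surj h"
    using surjection_real_data by blast
  define e where "e = fst \<circ> h"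
  \<comment> \<open>Otherwise all indices of the task lie in a countable initial segment, although
    the second component of \<open>h\<close> maps them onto the reals.\<close>
  have cof: "\<exists>y. (x, y) \<in> R \<and> e y = d" for x d
  proof (rule ccontr)
    assume "\<not> ?thesis"
    then have "{y. e y = d} \<subseteq> insert x {s. (s, x) \<in> R}" using R(3) by blast
    then have "countable {y. e y = d}" using R(4) by (meson countable_insert countable_subset)
    then have "countable ((snd \<circ> h) ` {y. e y = d})" by (rule countable_image)
    moreover have "(snd \<circ> h) ` {y. e y = d} = UNIV"
    proof (intro equalityI subsetI)
      fix t :: real
      obtain y where "h y = (d, t)" using h by (metis surjD)
      then show "t \<in> (snd \<circ> h) ` {y. e y = d}" by (intro image_eqI[of _ _ y]) (simp_all add: e_def)
    qed simp
    ultimately show False using uncountable_UNIV_real by simp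
  qed
  have "\<exists>f :: real \<Rightarrow> (nat \<times> nat) set. \<forall>x. extends R e f x (f x)"
  proof (rule dependent_wf_choice[OF R(1)])
    fix f g :: "real \<Rightarrow> (nat \<times> nat) set" and x r assume fg: "\<And>z. (z, x) \<in> R \<Longrightarrow> f z = g z"
    have s: "stage R f x = stage R g x" by (rule stage_cong[OF fg])
    have "committed R f e d = committed R g e d" if "d = x \<or> (d, x) \<in> R" for d
    proof -
      have "stage R f d = stage R g d"
        by (rule stage_cong) (use fg that R(2) in \<open>blast dest: transD\<close>)
      then show ?thesis by (simp add: committed_def)
    qed
    then show "extends R e f x r = extends R e g x r" unfolding extends_def s by blast
  next
    fix x and f :: "real \<Rightarrow> (nat \<times> nat) set" assume "\<And>y. (y, x) \<in> R \<Longrightarrow> extends R e f y (f y)"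
    then show "\<exists>r. extends R e f x r" by (rule extension_exists[OF R])
  qed
  then obtain f where "\<forall>x. extends R e f x (f x)" by blast
  then have "tower R e f" using R cof by unfold_locales auto
  then show ?thesis by blast
qed

context tower begin

abbreviation st :: "real \<Rightarrow> (nat \<times> nat) set set" where "st \<equiv> stage R f"

definition alg :: "(nat \<times> nat) set set" where "alg = (\<Union>x. st x)"

lemma above: "\<exists>y. (x, y) \<in> R"
  using cofinal by blast

lemma st_le: "x = y \<or> (x, y) \<in> R \<Longrightarrow> st x \<subseteq> st y"
  using stage_mono[OF trans] by blast

lemma algebra_alg: "algebra UNIV alg"
proof (rule algebra_UNIV_I)
  show "{} \<in> alg" by (auto simp: alg_def stage_def balg.empty)
next
  fix A assume "A \<in> alg"
  then show "- A \<in> alg" by (auto simp: alg_def stage_def intro: balg.compl)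
next
  fix A B assume "A \<in> alg" "B \<in> alg"
  then obtain x y where xy: "A \<in> st x" "B \<in> st y" by (auto simp: alg_def)
  obtain z where "A \<in> st z" "B \<in> st z"
    using tot[of x y] st_le xy by blast
  then show "A \<inter> B \<in> alg" by (auto simp: alg_def stage_def intro: balg.inter)
qed

lemma st_alg: "st x \<subseteq> alg"
  by (auto simp: alg_def)

lemma gens_alg: "balg gens \<subseteq> alg"
  using gens_stage st_alg by blast

lemma f_alg: "f x \<in> alg"
  using above gen_stage st_alg by blast

text \<open>A countable unbounded set would exhibit the reals as a countable union of countable
  segments.\<close>

lemma countable_bounded:
  assumes "countable C" shows "\<exists>x. \<forall>c\<in>C. (c, x) \<in> R"
proof (rule ccontr)
  assume "\<not> ?thesis"
  then have "\<And>x. \<exists>c\<in>C. x = c \<or> (x, c) \<in> R" using tot by blast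
  then have "UNIV \<subseteq> (\<Union>c\<in>C. insert c {s. (s, c) \<in> R})" by blast
  moreover have "countable (\<Union>c\<in>C. insert c {s. (s, c) \<in> R})"
    using assms countable_below by (intro countable_UN) auto
  ultimately show False using uncountable_UNIV_real countable_subset by blast
qed

lemma sequence_in_stage:
  assumes "\<And>j::nat. S j \<in> alg" shows "\<exists>x. \<forall>j. S j \<in> st x"
proof -
  obtain y where y: "\<And>j. S j \<in> st (y j)" using assms by (auto simp: alg_def) metis
  obtain x where "\<forall>c\<in>range y. (c, x) \<in> R" using countable_bounded[of "range y"] by auto
  then have "S j \<in> st x" for j using y[of j] st_le[of "y j" x] by auto
  then show ?thesis by blast
qed

lemma per_alg: "alg \<subseteq> per" and lam_convergent: "A \<in> alg \<Longrightarrow> convergent (\<lambda>n. lam n A)"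
proof -
  have "A \<in> per \<and> convergent (\<lambda>n. lam n A)" if "A \<in> alg" for A
  proof -
    obtain x where x: "A \<in> st x" using \<open>A \<in> alg\<close> by (auto simp: alg_def)
    show ?thesis
      by (rule stage_lam_convergent[OF wf trans tot _ _ x]) (use extends in \<open>auto simp: extends_def\<close>)
  qed
  then show "alg \<subseteq> per" "A \<in> alg \<Longrightarrow> convergent (\<lambda>n. lam n A)" by auto
qed

lemma fin_add_mu: "fin_add alg mu" and lam_tendsto_mu: "A \<in> alg \<Longrightarrow> (\<lambda>n. lam n A) \<longlonglongrightarrow> mu A"
  and mu_UNIV: "mu UNIV = 1"
  using mu_fin_add[OF algebra_alg per_alg lam_convergent] by auto

text \<open>The task with all rows equal to \<open>S\<close> recurs above a stage that contains
  every \<open>S j\<close>.\<close>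

lemma commit:
  assumes S: "\<And>j. S j \<in> alg" "\<And>j. mu (S j) \<le> (1/2)^j"
  shows "\<exists>d. (\<forall>j. S j \<in> st d) \<and> committed R f e d \<and> e d 0 = S"
proof -
  obtain x where x: "\<forall>j. S j \<in> st x" using sequence_in_stage[of S] S by blast
  obtain d where d: "(x, d) \<in> R" "e d = (\<lambda>k. S)" using cofinal by blast
  have "S j \<in> st d" for j using x d(1) st_le by blast
  then show ?thesis using d S by (intro exI[of _ d]) (simp add: committed_def)
qed

text \<open>Induction over the generators \<open>f x\<close>: before \<open>d\<close> they belong to
  \<open>st d\<close>; from \<open>d\<close> on the commitment puts almost all
  \<open>f x \<inter> e d 0 j\<close> into \<open>st x\<close>, which lies in \<open>W\<close> by
  the induction hypothesis, and the last claim of \<open>decided_algebra\<close> applies.\<close>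

lemma decided:
  assumes p: "fin_add alg p" and d: "committed R f e d" and "A \<in> alg" "0 < \<epsilon>"
  shows "\<exists>B\<in>st d. \<exists>B'\<in>st d. B \<subseteq> A \<and> B' \<inter> A = {} \<and> (\<exists>j0. \<forall>j\<ge>j0. p (e d 0 j - (B \<union> B')) \<le> \<epsilon>)"
proof -
  interpret fin_add alg p by fact
  define W where "W = {A\<in>alg. \<forall>\<epsilon>>0. \<exists>B\<in>st d. \<exists>B'\<in>st d. B \<subseteq> A \<and> B' \<inter> A = {} \<and>
                     (\<exists>j0. \<forall>j\<ge>j0. p (e d 0 j - (B \<union> B')) \<le> \<epsilon>)}"
  have S: "e d 0 j \<in> st d" for j using d by (simp add: committed_def)
  have S': "e d 0 j \<in> alg" for j using S st_alg by blast
  note dec = decided_algebra[where S = "\<lambda>j. e d 0 j" and N = "st d", OF algebra_stage st_alg S', folded W_def]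
  have fW: "f x \<in> W" for x
    using wf
  proof (induction x rule: wf_induct_rule)
    case (less x)
    show ?case
    proof (cases "(x, d) \<in> R")
      case True
      then show ?thesis using gen_stage[OF True, of f] dec(2) by blast
    next
      case False
      then have dx: "d = x \<or> (d, x) \<in> R" using tot[of d x] by auto
      have "gens \<subseteq> st d" using gens_stage[of R f d] by (auto intro: balg.gen)
      then have "gens \<union> f ` {s. (s, x) \<in> R} \<subseteq> W" using dec(2) less by auto
      then have xW: "st x \<subseteq> W" unfolding stage_def by (rule balg_least[OF dec(1)])
      obtain m where "\<forall>j\<ge>m. f x \<inter> e d 0 j \<in> st x"
        using extends[of x] d dx unfolding extends_def by blast
      then show ?thesis using xW by (intro dec(3)[OF f_alg S, of m]) auto
    qed
  qed
  have "gens \<subseteq> st d" using gens_stage[of R f d] by (auto intro: balg.gen)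
  then have "gens \<subseteq> W" using dec(2) by blast
  then have "st x \<subseteq> W" for x unfolding stage_def using fW by (intro balg_least[OF dec(1)]) auto
  then have "A \<in> W" using assms(3) by (auto simp: alg_def)
  then show ?thesis using \<open>0 < \<epsilon>\<close> unfolding W_def by blast
qed

end

section \<open>Stone spaces and their probability functionals\<close>

text \<open>\<open>c A\<close> is the clopen set of \<open>A\<close>. \<open>c_point\<close> places
  every \<open>d\<close> in the space through its principal ultrafilter, which turns atomic measures
  into elements of \<open>coDelta X\<close>.\<close>

locale stone_space = algebra UNIV M for M :: "'d set set" +
  fixes X :: "'b topology" and c :: "'d set \<Rightarrow> 'b set"
  assumes compact: "compact_space X"
    and Hausdorff: "Hausdorff_space X"
    and c_open: "A \<in> M \<Longrightarrow> openin X (c A)"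
    and c_UNIV: "c UNIV = topspace X"
    and c_Int: "A \<in> M \<Longrightarrow> B \<in> M \<Longrightarrow> c (A \<inter> B) = c A \<inter> c B"
    and c_compl: "A \<in> M \<Longrightarrow> c (- A) = topspace X - c A"
    and c_base: "openin X U \<Longrightarrow> x \<in> U \<Longrightarrow> \<exists>A\<in>M. x \<in> c A \<and> c A \<subseteq> U"
    and c_point: "\<exists>x\<in>topspace X. \<forall>A\<in>M. x \<in> c A \<longleftrightarrow> d \<in> A"

text \<open>Points are ultrafilters of \<open>M\<close>, coded as truth-valued functions that are
  false off \<open>M\<close>; they form a closed subset of a compact power of \<open>bool\<close>.
  The injection \<open>h\<close> transports this space to the required type.\<close>

lemma stone_space_exists:
  fixes M :: "'d set set" and h :: "'d set \<Rightarrow> 'b"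
  assumes alg: "algebra UNIV M" and h: "inj h"
  shows "\<exists>(X :: 'b set topology) c. stone_space M X c"
proof -
  interpret algebra UNIV M by fact
  define Z where "Z = product_topology (\<lambda>_. discrete_topology (UNIV :: bool set)) (UNIV :: 'd set set)"
  have tZ: "topspace Z = UNIV" by (auto simp: Z_def)
  define P where "P = (\<lambda>A::'d set. {x::'d set \<Rightarrow> bool. x A})"
  have Pre: "openin Z {x. x A \<in> V}" "closedin Z {x. x A \<in> V}" for A V
  proof -
    have c: "continuous_map Z (discrete_topology UNIV) (\<lambda>x. x A)"
      unfolding Z_def by (rule continuous_map_product_projection) simp
    show "openin Z {x. x A \<in> V}" using openin_continuous_map_preimage[OF c, of V] by (simp add: tZ)
    show "closedin Z {x. x A \<in> V}" using closedin_continuous_map_preimage[OF c, of V] by (simp add: tZ)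
  qed
  have oP: "openin Z (P A)" and cP: "closedin Z (P A)" and cQ: "closedin Z (- P A)" for A
    using Pre[of A "{True}"] Pre[of A "{False}"] by (auto simp: P_def Compl_eq)
  define K1 where "K1 = (\<lambda>A. {x::'d set \<Rightarrow> bool. x (- A) = (\<not> x A)})"
  define K2 where "K2 = (\<lambda>(A, B). {x::'d set \<Rightarrow> bool. x (A \<inter> B) = (x A \<and> x B)})"
  define K where "K = {x. (\<forall>A\<in>M. x (- A) = (\<not> x A)) \<and> (\<forall>A\<in>M. \<forall>B\<in>M. x (A \<inter> B) = (x A \<and> x B)) \<and> (\<forall>A. A \<notin> M \<longrightarrow> \<not> x A)}"
  have "closedin Z K"
  proof -
    have 1: "closedin Z (K1 A)" for A
    proof -
      have "K1 A = (P (- A) \<inter> - P A) \<union> (- P (- A) \<inter> P A)" by (auto simp: K1_def P_def)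
      then show ?thesis using cP cQ by (auto intro!: closedin_Un closedin_Int)
    qed
    have 2: "closedin Z (K2 AB)" for AB
    proof -
      obtain A B where AB: "AB = (A, B)" by (cases AB)
      have "K2 AB = (P (A \<inter> B) \<inter> (P A \<inter> P B)) \<union> (- P (A \<inter> B) \<inter> (- P A \<union> - P B))" by (auto simp: AB K2_def P_def)
      then show ?thesis using cP cQ by (auto intro!: closedin_Un closedin_Int)
    qed
    have "K = \<Inter> (K1 ` M \<union> K2 ` (M \<times> M) \<union> (\<lambda>A. - P A) ` (- M) \<union> {UNIV})"
      by (auto simp: K_def K1_def K2_def P_def)
    also have "closedin Z \<dots>"
      using 1 2 cQ closedin_topspace[of Z, unfolded tZ] by (intro closedin_Inter) auto
    finally show ?thesis .
  qed
  then have cK: "compactin Z K"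
    by (intro closedin_compact_space)
       (auto simp: Z_def compact_space_product_topology compact_space_discrete_topology)
  have hZ: "Hausdorff_space Z" by (simp add: Z_def Hausdorff_space_product_topology Hausdorff_space_discrete_topology)
  \<comment> \<open>\<open>g x\<close> stores the ultrafilter \<open>x\<close> as a set of codes,
    and \<open>f\<close> reads it back.\<close>
  define g where "g = (\<lambda>x::'d set \<Rightarrow> bool. h ` {A. x A})"
  define f where "f = (\<lambda>Q A. h A \<in> Q)"
  have fg: "f (g x) = x" for x using h by (auto simp: f_def g_def inj_def)
  define X where "X = pullback_topology (g ` K) f Z"
  have oX: "openin X S \<longleftrightarrow> (\<exists>U. openin Z U \<and> S = f -` U \<inter> g ` K)" for S
    by (simp add: X_def openin_pullback_topology)
  have tX: "topspace X = g ` K" by (simp add: X_def topspace_pullback_topology tZ)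
  have fcont: "continuous_map X Z f"
    unfolding X_def using continuous_map_pullback[of Z Z id] by simp
  have gcont: "continuous_map (subtopology Z K) X g"
  proof -
    have "continuous_map (subtopology Z K) Z (f \<circ> g)"
      using fg by (simp add: comp_def continuous_map_from_subtopology)
    then show ?thesis unfolding X_def
      by (intro continuous_map_pullback') (auto simp: tZ)
  qed
  have "compactin X (g ` K)"
    using image_compactin[OF _ gcont] cK by (simp add: compactin_subtopology)
  then have comp: "compact_space X" by (simp add: compact_space_def tX)
  have "inj_on f (topspace X)" using fg by (auto simp: tX inj_on_def)
  then have haus: "Hausdorff_space X" using Hausdorff_space_injective_preimage[OF hZ fcont] by blast
  define c where "c = (\<lambda>A. {Q \<in> topspace X. h A \<in> Q})"
  have hg: "h A \<in> g x \<longleftrightarrow> x A" for A x using fg[of x] by (metis f_def)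
  have K_D: "x (- A) = (\<not> x A)" "x (A \<inter> B) = (x A \<and> x B)" if "x \<in> K" "A \<in> M" "B \<in> M" for x A B
    using that by (auto simp: K_def)
  have K_UNIV: "x UNIV" if "x \<in> K" for x
    using K_D(1)[OF that, of "{}"] K_D(1)[OF that, of UNIV] K_D(2)[OF that, of "{}" UNIV] by auto
  have fK: "f Q \<in> K" if "Q \<in> g ` K" for Q using that fg by auto
  have cD: "Q \<in> c A \<longleftrightarrow> Q \<in> g ` K \<and> f Q A" for Q A by (auto simp: c_def tX f_def)
  have "stone_space M X c"
  proof
    show "compact_space X" "Hausdorff_space X" by fact+
    show "openin X (c A)" for A
      unfolding oX by (rule exI[of _ "P A"]) (use oP in \<open>auto simp: c_def tX f_def P_def\<close>)
    show "c UNIV = topspace X" using K_UNIV by (auto simp: c_def tX hg)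
    show "c (A \<inter> B) = c A \<inter> c B" if "A \<in> M" "B \<in> M" for A B
      using K_D(2)[OF fK that] by (auto simp: cD)
    show "c (- A) = topspace X - c A" if "A \<in> M" for A
      using K_D(1)[OF fK that that] by (auto simp: cD tX)
    show "\<exists>A\<in>M. x \<in> c A \<and> c A \<subseteq> U" if U: "openin X U" "x \<in> U" for x U
    proof -
      obtain V where V: "openin Z V" "U = f -` V \<inter> g ` K" using U(1) unfolding oX by blast
      obtain y where y: "y \<in> K" "x = g y" "y \<in> V" using U(2) unfolding V(2) by (auto simp: fg)
      obtain W where W: "finite {i. W i \<noteq> (UNIV :: bool set)}" "y \<in> Pi\<^sub>E UNIV W" "Pi\<^sub>E UNIV W \<subseteq> V"
        using V(1) y(3) unfolding Z_def openin_product_topology_alt by (auto 0 4)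
      \<comment> \<open>A basic neighbourhood restricts finitely many coordinates. On
        \<open>K\<close> those in \<open>M\<close> are fixed by a single \<open>B\<close>, a finite
        intersection of sets and complements, and those off \<open>M\<close> are constantly
        false.\<close>
      have "\<exists>B\<in>M. y B \<and> (\<forall>z\<in>K. z B \<longrightarrow> (\<forall>A\<in>J. z A = y A))" if "finite J" for J
        using that
      proof (induction J rule: finite_induct)
        case empty
        then show ?case using K_UNIV[OF y(1)] by auto
      next
        case (insert A J)
        then obtain B where B: "B \<in> M" "y B" "\<forall>z\<in>K. z B \<longrightarrow> (\<forall>A\<in>J. z A = y A)" by blast
        show ?case
        proof (cases "A \<in> M")
          case True
          define A' where "A' = (if y A then A else - A)"
          have A': "A' \<in> M" using True by (auto simp: A'_def intro: algebra_UNIV_compl[OF alg])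
          have zA': "z A' \<longleftrightarrow> z A = y A" if "z \<in> K" for z
            using K_D(1)[OF that True True] by (auto simp: A'_def)
          have zBA: "z (B \<inter> A') \<longleftrightarrow> z B \<and> z A = y A" if "z \<in> K" for z
            using K_D(2)[OF that B(1) A'] zA'[OF that] by simp
          show ?thesis
          proof (intro bexI[of _ "B \<inter> A'"] conjI ballI impI)
            show "y (B \<inter> A')" using zBA[OF y(1)] B(2) by simp
            show "z C = y C" if "z \<in> K" "z (B \<inter> A')" "C \<in> insert A J" for z C
              using that zBA[OF that(1)] B(3) by blast
          qed (use B(1) A' in blast)
        next
          case False
          then have "z A = y A" if "z \<in> K" for z using that y(1) by (auto simp: K_def)
          then show ?thesis using B by auto
        qed
      qed
      from this[OF W(1)] obtain B where B: "B \<in> M" "y B" "\<forall>z\<in>K. z B \<longrightarrow> (\<forall>A\<in>{i. W i \<noteq> UNIV}. z A = y A)"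
        by blast
      show ?thesis
      proof (intro bexI[of _ B] conjI subsetI)
        show "x \<in> c B" using y B(2) by (auto simp: c_def tX hg)
        fix u assume "u \<in> c B"
        then obtain z where z: "z \<in> K" "u = g z" "z B" by (auto simp: c_def tX hg)
        have "z \<in> Pi\<^sub>E UNIV W"
        proof (rule PiE_I)
          fix i show "z i \<in> W i"
          proof (cases "W i = UNIV")
            case False
            then have "z i = y i" using B(3) z(1,3) by blast
            then show ?thesis using PiE_mem[OF W(2), of i] by simp
          qed simp
        qed auto
        then have "z \<in> V" using W(3) by blast
        then show "u \<in> U" unfolding V(2) using z(1,2) by (simp add: fg)
      qed (rule B(1))
    qed
    show "\<exists>x\<in>topspace X. \<forall>A\<in>M. (x \<in> c A) = (d \<in> A)" for d
    proof -
      have "(\<lambda>A. A \<in> M \<and> d \<in> A) \<in> K"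
        using algebra_UNIV_compl[OF alg] by (auto simp: K_def)
      then show ?thesis
        by (intro bexI[of _ "g (\<lambda>A. A \<in> M \<and> d \<in> A)"]) (auto simp: c_def tX hg)
    qed
  qed
  then show ?thesis by blast
qed

section \<open>Probability functionals on continuous functions\<close>

lemma one_cfun: "(\<lambda>x. if x \<in> topspace X then 1 else 0) \<in> cfun X"
proof -
  have "continuous_map X euclideanreal (\<lambda>x. if x \<in> topspace X then 1 else (0::real))"
    by (rule continuous_map_eq[of X euclideanreal "\<lambda>x. 1"]) auto
  then show ?thesis by (simp add: cfun_def)
qed

lemma cfun_lin: "f \<in> cfun X \<Longrightarrow> g \<in> cfun X \<Longrightarrow> (\<lambda>x. a * f x + b * g x) \<in> cfun X"
  by (auto simp: cfun_def intro!: continuous_map_add continuous_map_real_mult)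

context
  fixes X :: "'b topology" and \<phi> :: "('b \<Rightarrow> real) \<Rightarrow> real"
  assumes phi: "\<phi> \<in> probm X"
begin

lemma probm_lin: "f \<in> cfun X \<Longrightarrow> g \<in> cfun X \<Longrightarrow> \<phi> (\<lambda>x. a * f x + b * g x) = a * \<phi> f + b * \<phi> g"
  using phi unfolding probm_def meas_def by blast

lemma probm_add: "f \<in> cfun X \<Longrightarrow> g \<in> cfun X \<Longrightarrow> \<phi> (\<lambda>x. f x + g x) = \<phi> f + \<phi> g"
  using probm_lin[of f g 1 1] by simp

lemma probm_nonneg: "f \<in> cfun X \<Longrightarrow> (\<And>x. x \<in> topspace X \<Longrightarrow> 0 \<le> f x) \<Longrightarrow> 0 \<le> \<phi> f"
  using phi unfolding probm_def by blast

lemma probm_one: "\<phi> (\<lambda>x. if x \<in> topspace X then 1 else 0) = 1"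
  using phi unfolding probm_def by blast

text \<open>Positivity is applied to \<open>\<epsilon> + s * (f - g)\<close> for
  \<open>s = 1\<close> and \<open>s = -1\<close>.\<close>

lemma probm_close:
  assumes f: "f \<in> cfun X" and g: "g \<in> cfun X" and le: "\<And>x. x \<in> topspace X \<Longrightarrow> \<bar>f x - g x\<bar> \<le> \<epsilon>"
  shows "\<bar>\<phi> f - \<phi> g\<bar> \<le> \<epsilon>"
proof -
  let ?one = "\<lambda>x. if x \<in> topspace X then 1 else (0::real)"
  have fg: "(\<lambda>x. 1 * f x + (-1) * g x) \<in> cfun X" using f g by (rule cfun_lin)
  have "0 \<le> \<phi> (\<lambda>x. \<epsilon> * ?one x + s * (1 * f x + (-1) * g x))" if "s = 1 \<or> s = -1" for s
    by (rule probm_nonneg[OF cfun_lin[OF one_cfun fg]]) (use le that in force)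
  then have "0 \<le> \<epsilon> * 1 + s * (\<phi> f - \<phi> g)" if "s = 1 \<or> s = -1" for s
    using that unfolding probm_lin[OF one_cfun fg] probm_lin[OF f g] probm_one by fastforce
  from this[of 1] this[of "-1"] show ?thesis by auto
qed

end

lemma probm_limit:
  assumes s: "\<And>n. s n \<in> probm X" and \<mu>: "\<mu> \<in> meas X" and w: "wconv X s \<mu>"
  shows "\<mu> \<in> probm X"
proof -
  have lim: "(\<lambda>n. s n f) \<longlonglongrightarrow> \<mu> f" if "f \<in> cfun X" for f using w that by (simp add: wconv_def)
  have "0 \<le> \<mu> f" if "f \<in> cfun X" "\<forall>x\<in>topspace X. 0 \<le> f x" for f
    by (rule LIMSEQ_le_const[OF lim[OF that(1)]]) (use that probm_nonneg[OF s] in auto)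
  moreover have "\<mu> (\<lambda>x. if x \<in> topspace X then 1 else 0) = 1"
    using lim[OF one_cfun] by (simp add: probm_one[OF s] LIMSEQ_const_iff)
  ultimately show ?thesis using \<mu> by (simp add: probm_def)
qed

lemma coDelta_probm: "coDelta X \<subseteq> probm X"
proof
  fix \<phi> assume "\<phi> \<in> coDelta X"
  then obtain n :: nat and a t where a: "\<And>i. i < n \<Longrightarrow> 0 \<le> a i \<and> t i \<in> topspace X" "(\<Sum>i<n. a i) = 1"
    and \<phi>: "\<phi> = (\<lambda>f. \<Sum>i<n. a i * dirac X (t i) f)" unfolding coDelta_def by blast
  have ev: "\<phi> f = (\<Sum>i<n. a i * f (t i))" if "f \<in> cfun X" for f using that by (simp add: \<phi> dirac_def)
  have one: "\<phi> (\<lambda>x. if x \<in> topspace X then 1 else 0) = 1"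
  proof -
    have "(\<Sum>i<n. a i * (if t i \<in> topspace X then 1 else 0)) = (\<Sum>i<n. a i)"
      using a(1) by (intro sum.cong) auto
    then show ?thesis using a(2) by (simp add: ev[OF one_cfun])
  qed
  have pos: "0 \<le> \<phi> f" if "f \<in> cfun X" "\<forall>x\<in>topspace X. 0 \<le> f x" for f
    using that a by (auto simp: ev intro!: sum_nonneg)
  have "\<phi> \<in> meas X"
    unfolding meas_def
  proof (intro CollectI conjI ballI allI impI exI[of _ 1])
    fix f g u v assume fg: "f \<in> cfun X" "g \<in> cfun X"
    then have "(\<lambda>x. u * f x + v * g x) \<in> cfun X"
      by (auto simp: cfun_def intro!: continuous_map_add continuous_map_real_mult)
    then show "\<phi> (\<lambda>x. u * f x + v * g x) = u * \<phi> f + v * \<phi> g"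
      using fg by (simp add: ev sum_distrib_left sum.distrib algebra_simps)
  next
    fix f assume f: "f \<in> cfun X" "\<forall>x\<in>topspace X. \<bar>f x\<bar> \<le> 1"
    have "\<bar>\<phi> f\<bar> \<le> (\<Sum>i<n. \<bar>a i * f (t i)\<bar>)" using ev[OF f(1)] by simp
    also have "\<dots> \<le> (\<Sum>i<n. a i)"
      by (intro sum_mono) (use a f(2) in \<open>auto simp: abs_mult intro!: mult_left_le\<close>)
    finally show "\<bar>\<phi> f\<bar> \<le> 1" using a by simp
  next
    fix f assume "f \<notin> cfun X"
    then show "\<phi> f = 0" by (simp add: \<phi> dirac_def)
  qed
  then show "\<phi> \<in> probm X" using one pos by (simp add: probm_def)
qed

lemma seqcl_probm: "seqcl X (coDelta X) \<subseteq> probm X"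
proof
  fix \<mu> assume "\<mu> \<in> seqcl X (coDelta X)"
  then show "\<mu> \<in> probm X"
  proof induction
    case (lim s \<mu>)
    show ?case by (rule probm_limit[OF lim.IH lim.hyps(2,3)])
  qed (use coDelta_probm in auto)
qed

section \<open>Clopen sets, simple functions and induced set functions\<close>

context stone_space begin

lemma compl_closed: "A \<in> M \<Longrightarrow> - A \<in> M"
  by (rule algebra_UNIV_compl) (rule algebra_axioms)

lemma c_empty: "c {} = {}"
  using c_compl[of UNIV] c_UNIV by simp

lemma c_Un: assumes "A \<in> M" "B \<in> M" shows "c (A \<union> B) = c A \<union> c B"
proof -
  have "A \<union> B = - (- A \<inter> - B)" by simp
  moreover have "c (- (- A \<inter> - B)) = topspace X - ((topspace X - c A) \<inter> (topspace X - c B))"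
    using assms compl_closed by (simp only: c_compl c_Int Int)
  moreover have "c A \<subseteq> topspace X" "c B \<subseteq> topspace X" using assms c_open openin_subset by blast+
  ultimately show ?thesis by (simp only:) blast
qed

lemma c_Diff: assumes "A \<in> M" "B \<in> M" shows "c (A - B) = c A - c B"
proof -
  have "c (A \<inter> - B) = c A \<inter> (topspace X - c B)"
    using assms compl_closed by (simp only: c_compl c_Int)
  moreover have "c A \<subseteq> topspace X" using assms c_open openin_subset by blast
  ultimately show ?thesis by (simp only: Diff_eq[of A B]) blast
qed

lemma c_UN: "finite I \<Longrightarrow> (\<And>i. i \<in> I \<Longrightarrow> A i \<in> M) \<Longrightarrow> c (\<Union>i\<in>I. A i) = (\<Union>i\<in>I. c (A i))"
proof (induction I rule: finite_induct)
  case (insert x F)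
  have "(\<Union>i\<in>F. A i) \<in> M" using insert.hyps insert.prems by (intro finite_UN) auto
  then have "c (A x \<union> (\<Union>i\<in>F. A i)) = c (A x) \<union> c (\<Union>i\<in>F. A i)" using insert.prems by (intro c_Un) auto
  then show ?case using insert.IH insert.prems by simp
qed (simp add: c_empty)

definition ind :: "'d set \<Rightarrow> 'b \<Rightarrow> real" where
  "ind A x = (if x \<in> c A then 1 else 0)"

definition msr :: "(('b \<Rightarrow> real) \<Rightarrow> real) \<Rightarrow> 'd set \<Rightarrow> real" where
  "msr \<phi> A = \<phi> (ind A)"

lemma ind_cfun: assumes "A \<in> M" shows "ind A \<in> cfun X"
proof -
  have s: "c A \<subseteq> topspace X" using assms c_open openin_subset by blast
  have "openin X {x \<in> topspace X. ind A x \<in> U}" for U :: "real set"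
  proof -
    have "{x \<in> topspace X. ind A x \<in> U} = (if 1 \<in> U then c A else {}) \<union> (if 0 \<in> U then c (- A) else {})"
      using s c_compl[OF assms] by (auto simp: ind_def)
    also have "openin X \<dots>" using c_open[OF assms] c_open[OF compl_closed[OF assms]] by (auto intro!: openin_Un)
    finally show ?thesis .
  qed
  then have "continuous_map X euclideanreal (ind A)" by (auto simp: continuous_map_def)
  then show ?thesis using s by (auto simp: cfun_def ind_def)
qed

inductive_set simple :: "('b \<Rightarrow> real) set" where
  zero: "(\<lambda>x. 0) \<in> simple"
| plus: "g \<in> simple \<Longrightarrow> A \<in> M \<Longrightarrow> (\<lambda>x. g x + a * ind A x) \<in> simple"

lemma zero_cfun: "(\<lambda>x. 0) \<in> cfun X"
  by (simp add: cfun_def)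

lemma simple_cfun: "g \<in> simple \<Longrightarrow> g \<in> cfun X"
proof (induction rule: simple.induct)
  case (plus g A a)
  then show ?case using ind_cfun[of A]
    by (auto simp: cfun_def intro!: continuous_map_add continuous_map_real_mult)
qed (rule zero_cfun)

text \<open>Compactness gives finitely many clopen sets on each of which \<open>f\<close> is within
  \<open>\<epsilon>\<close> of a constant; they are made disjoint one at a time.\<close>

lemma simple_approx:
  assumes f: "f \<in> cfun X" and e: "0 < \<epsilon>"
  shows "\<exists>g\<in>simple. \<forall>x\<in>topspace X. \<bar>f x - g x\<bar> \<le> \<epsilon>"
proof -
  define \<A> where "\<A> = {A \<in> M. \<exists>a. \<forall>x\<in>c A. \<bar>f x - a\<bar> \<le> \<epsilon>}"
  have cov: "\<exists>A\<in>\<A>. x \<in> c A" if x: "x \<in> topspace X" for x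
  proof -
    have "openin X {y \<in> topspace X. f y \<in> ball (f x) \<epsilon>}"
      using f by (intro openin_continuous_map_preimage[of X euclideanreal]) (auto simp: cfun_def)
    moreover have "x \<in> {y \<in> topspace X. f y \<in> ball (f x) \<epsilon>}" using x e by auto
    ultimately obtain A where "A \<in> M" "x \<in> c A" "c A \<subseteq> {y \<in> topspace X. f y \<in> ball (f x) \<epsilon>}"
      using c_base by blast
    then show ?thesis unfolding \<A>_def
      by (intro bexI[of _ A] CollectI conjI exI[of _ "f x"]) (auto simp: dist_real_def)
  qed
  have "\<exists>\<F>. finite \<F> \<and> \<F> \<subseteq> c ` \<A> \<and> topspace X \<subseteq> \<Union>\<F>"
    by (rule compactinD[OF compact[unfolded compact_space_def]]) (use cov c_open in \<open>auto simp: \<A>_def\<close>)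
  then obtain \<B> where B: "finite \<B>" "\<B> \<subseteq> \<A>" "topspace X \<subseteq> (\<Union>A\<in>\<B>. c A)"
    by (metis finite_subset_image)
  have "\<exists>g\<in>simple. \<exists>U\<in>M. c U = (\<Union>A\<in>\<B>. c A) \<and> (\<forall>x\<in>c U. \<bar>f x - g x\<bar> \<le> \<epsilon>) \<and> (\<forall>x. x \<notin> c U \<longrightarrow> g x = 0)"
    using B(1,2)
  proof (induction \<B> rule: finite_induct)
    case empty
    then show ?case using simple.zero by (intro bexI[of _ "\<lambda>x. 0"] bexI[of _ "{}"]) (auto simp: c_empty)
  next
    case (insert A \<B>)
    then obtain g U where g: "g \<in> simple" "U \<in> M" "c U = (\<Union>A\<in>\<B>. c A)"
      "\<And>x. x\<in>c U \<Longrightarrow> \<bar>f x - g x\<bar> \<le> \<epsilon>" "\<And>x. x \<notin> c U \<Longrightarrow> g x = 0" by blast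
    obtain a where a: "A \<in> M" "\<And>x. x\<in>c A \<Longrightarrow> \<bar>f x - a\<bar> \<le> \<epsilon>" using insert.prems by (auto simp: \<A>_def)
    have AU: "A - U \<in> M" "A \<union> U \<in> M" using a(1) g(2) by auto
    show ?case
    proof (intro bexI[of _ "\<lambda>x. g x + a * ind (A - U) x"] bexI[of _ "A \<union> U"] conjI ballI allI impI)
      show "c (A \<union> U) = (\<Union>A\<in>insert A \<B>. c A)" using c_Un[OF a(1) g(2)] g(3) by simp
      show "\<bar>f x - (g x + a * ind (A - U) x)\<bar> \<le> \<epsilon>" if "x \<in> c (A \<union> U)" for x
      proof (cases "x \<in> c U")
        case True
        then show ?thesis using g(4)[OF True] by (simp add: ind_def c_Diff[OF a(1) g(2)])
      next
        case False
        then have "x \<in> c A" using that c_Un[OF a(1) g(2)] by blast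
        then show ?thesis using a(2) g(5)[OF False] False by (simp add: ind_def c_Diff[OF a(1) g(2)])
      qed
      show "g x + a * ind (A - U) x = 0" if "x \<notin> c (A \<union> U)" for x
        using that c_Un[OF a(1) g(2)] c_Diff[OF a(1) g(2)] g(5)[of x] by (auto simp: ind_def)
      show "(\<lambda>x. g x + a * ind (A - U) x) \<in> simple" by (rule simple.plus[OF g(1) AU(1)])
    qed (rule AU(2))
  qed
  then show ?thesis using B(3) by (metis subsetD)
qed

lemma msr_fin_add: assumes "\<phi> \<in> probm X" shows "fin_add M (msr \<phi>)"
proof
  fix A assume "A \<in> M"
  then show "0 \<le> msr \<phi> A" unfolding msr_def
    by (intro probm_nonneg[OF assms] ind_cfun) (auto simp: ind_def)
next
  fix A B assume AB: "A \<in> M" "B \<in> M" "A \<inter> B = {}"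
  have "c A \<inter> c B = {}" using c_Int[OF AB(1,2)] AB(3) c_empty by simp
  then have "ind (A \<union> B) = (\<lambda>x. ind A x + ind B x)"
    using c_Un[OF AB(1,2)] by (fastforce simp: ind_def fun_eq_iff)
  then show "msr \<phi> (A \<union> B) = msr \<phi> A + msr \<phi> B"
    unfolding msr_def using probm_add[OF assms ind_cfun[OF AB(1)] ind_cfun[OF AB(2)]] by (simp only:)
qed

lemma msr_UNIV: "\<phi> \<in> probm X \<Longrightarrow> msr \<phi> UNIV = 1"
  using probm_one[of \<phi> X] by (simp add: msr_def ind_def[abs_def] c_UNIV)

lemma msr_simple_plus:
  assumes "\<phi> \<in> probm X" "g \<in> simple" "A \<in> M"
  shows "\<phi> (\<lambda>x. g x + a * ind A x) = \<phi> g + a * msr \<phi> A"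
  using probm_lin[OF assms(1) simple_cfun[OF assms(2)] ind_cfun[OF assms(3)], of 1 a]
  by (simp add: msr_def)

lemma probm_zero: "\<phi> \<in> probm X \<Longrightarrow> \<phi> (\<lambda>x. 0) = 0"
  using probm_lin[OF _ zero_cfun zero_cfun, of \<phi> 0 0] by simp

lemma probm_eqI:
  assumes "\<phi> \<in> probm X" "\<psi> \<in> probm X" "\<And>A. A \<in> M \<Longrightarrow> msr \<phi> A = msr \<psi> A"
  shows "\<phi> = \<psi>"
proof
  fix f
  show "\<phi> f = \<psi> f"
  proof (cases "f \<in> cfun X")
    case False
    then show ?thesis using assms(1,2) by (simp add: probm_def meas_def)
  next
    case True
    have "\<bar>\<phi> f - \<psi> f\<bar> \<le> 0 + e" if "e > 0" for e
    proof -
      obtain g where g: "g \<in> simple" "\<forall>x\<in>topspace X. \<bar>f x - g x\<bar> \<le> e/2"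
        using simple_approx[OF True, of "e/2"] \<open>e > 0\<close> by auto
      have "\<phi> g = \<psi> g" using g(1)
      proof induction
        case (plus g A a)
        then show ?case using msr_simple_plus[OF assms(1)] msr_simple_plus[OF assms(2)] assms(3) by simp
      qed (simp add: probm_zero[OF assms(1)] probm_zero[OF assms(2)])
      moreover have "\<bar>\<phi> f - \<phi> g\<bar> \<le> e/2"
        by (rule probm_close[OF assms(1) True simple_cfun[OF g(1)]]) (use g(2) in blast)
      moreover have "\<bar>\<psi> f - \<psi> g\<bar> \<le> e/2"
        by (rule probm_close[OF assms(2) True simple_cfun[OF g(1)]]) (use g(2) in blast)
      ultimately show ?thesis by linarith
    qed
    then have "\<bar>\<phi> f - \<psi> f\<bar> \<le> 0" by (rule field_le_epsilon)
    then show ?thesis by simp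
  qed
qed

text \<open>By linearity the values on simple functions converge; uniform approximation then makes
  the values on every continuous function Cauchy.\<close>

lemma probm_convergent:
  assumes s: "\<And>n. s n \<in> probm X" and conv: "\<And>A. A \<in> M \<Longrightarrow> convergent (\<lambda>n. msr (s n) A)"
  shows "\<exists>\<phi>\<in>probm X. wconv X s \<phi>"
proof -
  have cf: "convergent (\<lambda>n. s n f)" if f: "f \<in> cfun X" for f
  proof (rule Cauchy_convergent, rule metric_CauchyI)
    fix e :: real assume e: "e > 0"
    obtain g where g: "g \<in> simple" "\<forall>x\<in>topspace X. \<bar>f x - g x\<bar> \<le> e/4"
      using simple_approx[OF f, of "e/4"] e by auto
    have "convergent (\<lambda>n. s n g)" using g(1)
    proof induction
      case zero
      then show ?case using probm_zero[OF s] by (simp add: convergent_const)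
    next
      case (plus g A a)
      have "convergent (\<lambda>n. s n g + a * msr (s n) A)"
        by (intro convergent_add convergent_mult convergent_const plus.IH conv plus.hyps(2))
      then show ?case by (simp add: msr_simple_plus[OF s plus.hyps])
    qed
    then have "Cauchy (\<lambda>n. s n g)" by (rule convergent_Cauchy)
    then obtain n0 where n0: "\<And>n m. n \<ge> n0 \<Longrightarrow> m \<ge> n0 \<Longrightarrow> \<bar>s n g - s m g\<bar> < e/2"
      using e unfolding Cauchy_def dist_real_def by (meson half_gt_zero)
    have cl: "\<bar>s n f - s n g\<bar> \<le> e/4" for n
      using probm_close[OF s f simple_cfun[OF g(1)]] g(2) by blast
    have "dist (s m f) (s n f) < e" if "m \<ge> n0" "n \<ge> n0" for m n
      using n0[OF that] cl[of m] cl[of n] unfolding dist_real_def by linarith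
    then show "\<exists>M. \<forall>m\<ge>M. \<forall>n\<ge>M. dist (s m f) (s n f) < e" by blast
  qed
  \<comment> \<open>The value 0 off \<open>cfun X\<close> is demanded by the extensional definition
    of \<open>meas\<close>.\<close>
  define \<phi> where "\<phi> = (\<lambda>f. if f \<in> cfun X then lim (\<lambda>n. s n f) else 0)"
  have lim: "(\<lambda>n. s n f) \<longlonglongrightarrow> \<phi> f" if "f \<in> cfun X" for f
    using cf[OF that] that by (simp add: \<phi>_def convergent_LIMSEQ_iff)
  have "\<phi> \<in> meas X"
    unfolding meas_def
  proof (intro CollectI conjI ballI allI impI exI[of _ 1])
    fix f g a b assume fg: "f \<in> cfun X" "g \<in> cfun X"
    have "(\<lambda>n. s n (\<lambda>x. a * f x + b * g x)) \<longlonglongrightarrow> a * \<phi> f + b * \<phi> g"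
      unfolding probm_lin[OF s fg] by (intro tendsto_intros lim fg)
    then show "\<phi> (\<lambda>x. a * f x + b * g x) = a * \<phi> f + b * \<phi> g"
      using LIMSEQ_unique[OF lim[OF cfun_lin[OF fg]]] by blast
  next
    fix f assume f: "f \<in> cfun X" "\<forall>x\<in>topspace X. \<bar>f x\<bar> \<le> 1"
    have "\<bar>s n f\<bar> \<le> 1" for n
      using probm_close[OF s f(1) zero_cfun, of 1] f(2) by (simp add: probm_zero[OF s])
    then show "\<bar>\<phi> f\<bar> \<le> 1" using LIMSEQ_le_const2[OF tendsto_rabs[OF lim[OF f(1)]]] by blast
  qed (simp add: \<phi>_def)
  moreover have w: "wconv X s \<phi>" using lim by (simp add: wconv_def)
  ultimately have "\<phi> \<in> probm X" using probm_limit[of s X \<phi>] s by blast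
  then show ?thesis using w by blast
qed

section \<open>Set functions reached by iterated sequential limits\<close>

text \<open>Only values on \<open>M\<close> count, so limits can be taken with set functions in
  place of functionals.\<close>

definition reach :: "('d set \<Rightarrow> real) set" where
  "reach = {p. \<exists>\<phi>\<in>seqcl X (coDelta X). \<forall>A\<in>M. msr \<phi> A = p A}"

lemma reach_limit:
  assumes "\<And>n. q n \<in> reach" "\<And>A. A \<in> M \<Longrightarrow> (\<lambda>n. q n A) \<longlonglongrightarrow> p A"
  shows "p \<in> reach"
proof -
  obtain s where s: "\<And>n. s n \<in> seqcl X (coDelta X)" "\<And>n A. A \<in> M \<Longrightarrow> msr (s n) A = q n A"
  proof -
    have "\<forall>n. \<exists>\<phi>. \<phi> \<in> seqcl X (coDelta X) \<and> (\<forall>A\<in>M. msr \<phi> A = q n A)"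
      using assms(1) unfolding reach_def by blast
    then show ?thesis using that by metis
  qed
  have sp: "s n \<in> probm X" for n using s(1) seqcl_probm by blast
  have lim: "(\<lambda>n. msr (s n) A) \<longlonglongrightarrow> p A" if "A \<in> M" for A using assms(2)[OF that] s(2)[OF that] by simp
  have "convergent (\<lambda>n. msr (s n) A)" if "A \<in> M" for A using lim[OF that] by (auto simp: convergent_def)
  from probm_convergent[OF sp this] obtain \<phi> where \<phi>: "\<phi> \<in> probm X" "wconv X s \<phi>" by blast
  have "\<phi> \<in> seqcl X (coDelta X)"
    using seqcl.lim[OF s(1) _ \<phi>(2)] \<phi>(1) by (simp add: probm_def)
  moreover have "msr \<phi> A = p A" if "A \<in> M" for A
    using LIMSEQ_unique[OF _ lim[OF that]] \<phi>(2) ind_cfun[OF that] by (simp add: wconv_def msr_def)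
  ultimately show ?thesis by (auto simp: reach_def)
qed

lemma reach_probm:
  assumes "\<phi> \<in> probm X" "msr \<phi> \<in> reach"
  shows "\<phi> \<in> seqcl X (coDelta X)"
proof -
  obtain \<psi> where \<psi>: "\<psi> \<in> seqcl X (coDelta X)" "\<forall>A\<in>M. msr \<psi> A = msr \<phi> A"
    using assms(2) unfolding reach_def by blast
  have "\<phi> = \<psi>" by (rule probm_eqI) (use assms(1) \<psi> seqcl_probm in auto)
  then show ?thesis using \<psi>(1) by simp
qed

text \<open>The weight at \<open>d\<close> moves to the point given by the principal ultrafilter of
  \<open>d\<close>.\<close>

lemma atomic_reach:
  assumes q: "q \<in> atomic" and "q UNIV = 1"
  shows "q \<in> reach"
proof -
  have "\<exists>(n::nat) a t. (\<forall>i<n. 0 \<le> a i \<and> t i \<in> topspace X) \<and> (\<forall>A\<in>M. q A = (\<Sum>i<n. a i * ind A (t i)))"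
    using q
  proof induction
    case zero
    then show ?case by (intro exI[of _ 0]) simp
  next
    case (plus q b d)
    then obtain n :: nat and a t where IH: "\<forall>i<n. 0 \<le> a i \<and> t i \<in> topspace X" "\<forall>A\<in>M. q A = (\<Sum>i<n. a i * ind A (t i))"
      by blast
    obtain x where x: "x \<in> topspace X" "\<forall>A\<in>M. x \<in> c A \<longleftrightarrow> d \<in> A" using c_point by blast
    have "(\<Sum>i<Suc n. (a(n := b)) i * ind A ((t(n := x)) i)) = (\<Sum>i<n. a i * ind A (t i)) + b * ind A x" for A
      by (simp cong: sum.cong_simp)
    then show ?case using IH x plus.hyps
      by (intro exI[of _ "Suc n"] exI[of _ "a(n := b)"] exI[of _ "t(n := x)"])
         (auto simp: ind_def indicator_def less_Suc_eq)
  qed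
  then obtain n :: nat and a t where a: "\<And>i. i < n \<Longrightarrow> 0 \<le> a i \<and> t i \<in> topspace X"
    "\<And>A. A \<in> M \<Longrightarrow> q A = (\<Sum>i<n. a i * ind A (t i))" by blast
  define \<phi> where "\<phi> = (\<lambda>f. \<Sum>i<n. a i * dirac X (t i) f)"
  have "(\<Sum>i<n. a i) = q UNIV" unfolding a(2)[OF top] by (intro sum.cong) (auto simp: ind_def c_UNIV a(1))
  then have "\<phi> \<in> coDelta X" using a(1) assms(2) unfolding coDelta_def \<phi>_def
    by (intro CollectI exI[of _ n] exI[of _ a] exI[of _ t]) simp
  moreover have "msr \<phi> A = q A" if "A \<in> M" for A
    using that by (simp add: msr_def \<phi>_def dirac_def ind_cfun a(2))
  ultimately show ?thesis unfolding reach_def using seqcl.base by blast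
qed

lemma coDelta_support:
  assumes "\<phi> \<in> coDelta X"
  shows "\<exists>T. finite T \<and> T \<subseteq> topspace X \<and> (\<forall>A\<in>M. T \<subseteq> c A \<longrightarrow> msr \<phi> A = 1)"
proof -
  obtain n :: nat and a t where a: "\<And>i. i < n \<Longrightarrow> 0 \<le> a i \<and> t i \<in> topspace X" "(\<Sum>i<n. a i) = 1"
    and \<phi>: "\<phi> = (\<lambda>f. \<Sum>i<n. a i * dirac X (t i) f)" using assms unfolding coDelta_def by blast
  have "msr \<phi> A = 1" if "A \<in> M" "t ` {..<n} \<subseteq> c A" for A
  proof -
    have "msr \<phi> A = (\<Sum>i<n. a i)"
      unfolding msr_def \<phi> by (intro sum.cong) (use that ind_cfun in \<open>auto simp: dirac_def ind_def\<close>)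
    then show ?thesis using a by simp
  qed
  then show ?thesis using a(1) by (intro exI[of _ "t ` {..<n}"]) auto
qed

end

section \<open>Measures on the constructed space\<close>

context stone_space begin

text \<open>Positive multiples of reached set functions, so that pieces can be added without
  normalising; total mass 0 qualifies trivially.\<close>

definition cone :: "('d set \<Rightarrow> real) set" where
  "cone = {p. p UNIV > 0 \<longrightarrow> (\<lambda>A. p A / p UNIV) \<in> reach}"

text \<open>If the limit has positive mass, the masses are eventually positive and the normalised
  sequence converges.\<close>

lemma cone_limit:
  assumes q: "\<And>n. q n \<in> cone" and lim: "\<And>A. A \<in> M \<Longrightarrow> (\<lambda>n. q n A) \<longlonglongrightarrow> p A"
  shows "p \<in> cone"
  unfolding cone_def
proof (intro CollectI impI)
  assume p: "p UNIV > 0"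
  then have "\<forall>\<^sub>F n in sequentially. q n UNIV > 0"
    using order_tendstoD(1)[OF lim[OF top]] by blast
  then obtain N where N: "\<And>n. n \<ge> N \<Longrightarrow> q n UNIV > 0" by (auto simp: eventually_sequentially)
  show "(\<lambda>A. p A / p UNIV) \<in> reach"
  proof (rule reach_limit[of "\<lambda>n A. q (n + N) A / q (n + N) UNIV"])
    show "(\<lambda>A. q (n + N) A / q (n + N) UNIV) \<in> reach" for n
      using q[of "n + N"] N[of "n + N"] by (simp add: cone_def)
    show "(\<lambda>n. q (n + N) A / q (n + N) UNIV) \<longlonglongrightarrow> p A / p UNIV" if "A \<in> M" for A
      using p by (intro tendsto_divide LIMSEQ_ignore_initial_segment lim that top) simp
  qed
qed

lemma cone_atomic: assumes "q \<in> atomic" shows "q \<in> cone"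
  unfolding cone_def
proof (intro CollectI impI)
  assume q: "q UNIV > 0"
  have "(\<lambda>A. 1 / q UNIV * q A) \<in> reach"
    using q by (intro atomic_reach atomic_scale assms) auto
  then show "(\<lambda>A. q A / q UNIV) \<in> reach" by simp
qed

end

section \<open>Every probability functional is reached\<close>

locale tower_space = tower R e f + stone_space "tower.alg R f" X c
  for R e f and X :: "'b topology" and c
begin

text \<open>Two nested limits, from \<open>avg n k\<close> to \<open>lam n\<close> to
  \<open>mu\<close>; restriction to \<open>C i\<close> keeps the starting terms atomic.
  \<open>q\<close> is the part later used for the mass on \<open>S j\<close>.\<close>

lemma cone_combination:
  fixes N :: nat
  assumes C: "\<And>i. i < N \<Longrightarrow> C i \<in> alg \<and> 0 \<le> a i" and q: "q \<in> atomic"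
  shows "(\<lambda>A. (\<Sum>i<N. a i * mu (A \<inter> C i)) + q A) \<in> cone"
proof (rule cone_limit[of "\<lambda>n A. (\<Sum>i<N. a i * lam n (A \<inter> C i)) + q A"])
  fix n
  show "(\<lambda>A. (\<Sum>i<N. a i * lam n (A \<inter> C i)) + q A) \<in> cone"
  proof (rule cone_limit[of "\<lambda>k A. (\<Sum>i<N. a i * avg n k (A \<inter> C i)) + q A"])
    fix k
    show "(\<lambda>A. (\<Sum>i<N. a i * avg n k (A \<inter> C i)) + q A) \<in> cone"
      using C by (intro cone_atomic atomic_add[OF atomic_sum q] atomic_scale atomic_restrict avg_atomic) auto
  next
    fix A assume "A \<in> alg"
    then have "A \<inter> C i \<in> per" if "i < N" for i using C[OF that] per_alg by blast
    then show "(\<lambda>k. (\<Sum>i<N. a i * avg n k (A \<inter> C i)) + q A) \<longlonglongrightarrow> (\<Sum>i<N. a i * lam n (A \<inter> C i)) + q A"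
      by (intro tendsto_add tendsto_sum tendsto_mult tendsto_const avg_tendsto_lam) auto
  qed
next
  fix A assume "A \<in> alg"
  then have "A \<inter> C i \<in> alg" if "i < N" for i using C[OF that] by blast
  then show "(\<lambda>n. (\<Sum>i<N. a i * lam n (A \<inter> C i)) + q A) \<longlonglongrightarrow> (\<Sum>i<N. a i * mu (A \<inter> C i)) + q A"
    by (intro tendsto_add tendsto_sum tendsto_mult tendsto_const lam_tendsto_mu) auto
qed

lemma mu_reach: "mu \<in> reach"
proof -
  have "(\<lambda>A. (\<Sum>i<Suc 0. 1 * mu (A \<inter> UNIV)) + 0) \<in> cone"
    by (rule cone_combination) (auto intro: atomic.zero)
  then show ?thesis by (simp add: cone_def mu_UNIV)
qed

text \<open>\<open>q j\<close> reproduces \<open>p\<close> on \<open>e d 0 j\<close> for the first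
  \<open>j + 1\<close> sets of the countable algebra \<open>st d\<close>. On late
  \<open>e d 0 j\<close> a set of \<open>alg\<close> is sandwiched, up to small mass, between sets
  of \<open>st d\<close>.\<close>

lemma atomic_approx_sequence:
  assumes p: "fin_add alg p" and d: "committed R f e d"
  shows "\<exists>q. (\<forall>j. q j \<in> atomic) \<and> (\<forall>A\<in>alg. (\<lambda>j. q j A - p (A \<inter> e d 0 j)) \<longlonglongrightarrow> 0)"
proof -
  interpret p: fin_add alg p by fact
  have Sd: "e d 0 j \<in> st d" for j using d by (simp add: committed_def)
  have S: "e d 0 j \<in> alg" for j using Sd st_alg by blast
  have cnt: "countable (st d)" and ne: "st d \<noteq> {}"
    using countable_stage[OF countable_below, of f d] Sd by auto
  define B where "B = from_nat_into (st d)"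
  have rB: "range B = st d" unfolding B_def by (rule range_from_nat_into[OF ne cnt])
  have "\<exists>q\<in>atomic. (\<forall>A. q A = q (A \<inter> e d 0 j)) \<and> q UNIV = p (e d 0 j) \<and> (\<forall>D\<in>B ` {..j}. q D = p (D \<inter> e d 0 j))" for j
    using S rB st_alg by (intro p.atomic_approx) blast+
  then obtain q where q: "\<And>j. q j \<in> atomic" "\<And>j. q j UNIV = p (e d 0 j)"
      "\<And>j D. D \<in> B ` {..j} \<Longrightarrow> q j D = p (D \<inter> e d 0 j)"
    by metis
  have qfa: "fin_add UNIV (q j)" for j by (rule atomic_fin_add[OF q(1)])
  have "(\<lambda>j. q j A - p (A \<inter> e d 0 j)) \<longlonglongrightarrow> 0" if A: "A \<in> alg" for A
  proof (rule LIMSEQ_I)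
    fix r :: real assume r: "r > 0"
    obtain D D' j0 where D: "D \<in> st d" "D' \<in> st d" "D \<subseteq> A" "D' \<inter> A = {}"
      and j0: "\<And>j. j \<ge> j0 \<Longrightarrow> p (e d 0 j - (D \<union> D')) \<le> r/2"
      using decided[OF p d A, of "r/2"] r by auto
    \<comment> \<open>\<open>D\<close> and \<open>D'\<close> have fixed indices in the enumeration,
      so \<open>q j\<close> is exact on both once \<open>j\<close> passes them.\<close>
    obtain l l' where l: "D = B l" "D' = B l'" using D(1,2) rB by (metis rangeE)
    have Dalg: "D \<in> alg" "D' \<in> alg" using D st_alg by blast+
    have "\<bar>q j A - p (A \<inter> e d 0 j)\<bar> \<le> r/2" if j: "j \<ge> max j0 (max l l')" for j
    proof -
      interpret q: fin_add UNIV "q j" by (rule qfa)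
      let ?S = "e d 0 j"
      have eq: "q j D = p (D \<inter> ?S)" "q j D' = p (D' \<inter> ?S)" using q(3) l j by auto
      have le: "p (?S - (D \<union> D')) \<le> r/2" using j0 j by auto
      have "p (A \<inter> ?S) \<le> p ((D \<inter> ?S) \<union> (?S - (D \<union> D')))"
        by (rule p.mono) (use A Dalg S D(4) in auto)
      also have "\<dots> \<le> p (D \<inter> ?S) + p (?S - (D \<union> D'))"
        by (rule p.subadd) (use Dalg S in auto)
      finally have 1: "p (A \<inter> ?S) \<le> q j D + r/2" using eq le by simp
      have 2: "q j D \<le> q j A" by (rule q.mono) (use D in auto)
      have "q j A \<le> q j (UNIV - D')" by (rule q.mono) (use D in auto)
      also have "\<dots> = p ?S - p (D' \<inter> ?S)" using q.diff[of UNIV D'] eq q(2)[of j] by simp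
      also have "\<dots> = p (?S - D')" using p.split[OF S Dalg(2)] by (simp add: Int_commute)
      also have "\<dots> \<le> p ((D \<inter> ?S) \<union> (?S - (D \<union> D')))"
        by (rule p.mono) (use Dalg S in auto)
      also have "\<dots> \<le> p (D \<inter> ?S) + p (?S - (D \<union> D'))"
        by (rule p.subadd) (use Dalg S in auto)
      also have "p (D \<inter> ?S) \<le> p (A \<inter> ?S)"
        by (rule p.mono) (use A Dalg S D(3) in auto)
      finally have 3: "q j A \<le> p (A \<inter> ?S) + r/2" using le by simp
      show ?thesis using 1 2 3 by linarith
    qed
    then show "\<exists>no. \<forall>j\<ge>no. norm (q j A - p (A \<inter> e d 0 j) - 0) < r"
      using r by (intro exI[of _ "max j0 (max l l')"]) (force intro: le_less_trans[of _ "r/2"])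
  qed
  then show ?thesis using q(1) by blast
qed

text \<open>Split \<open>p A = p (A - S j) + p (A \<inter> S j)\<close> with \<open>S j\<close> from
  \<open>lebesgue_approx\<close>. The first part is close to a simple density against
  \<open>mu\<close>, the second, after committing to \<open>S\<close>, to the atomic
  \<open>q j\<close>; the approximants lie in \<open>cone\<close>.\<close>

lemma probm_seqcl: "probm X \<subseteq> seqcl X (coDelta X)"
proof
  fix \<phi> assume \<phi>: "\<phi> \<in> probm X"
  define p where "p = msr \<phi>"
  have p: "fin_add alg p" "p UNIV = 1" unfolding p_def using msr_fin_add[OF \<phi>] msr_UNIV[OF \<phi>] by auto
  interpret p: fin_add alg p by (rule p)
  define P where "P = (\<lambda>j (S, N, C, a). S \<in> alg \<and> mu S \<le> (1/2)^j \<and> (\<forall>i<N::nat. C i \<in> alg \<and> 0 \<le> a i) \<and>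
     (\<forall>A\<in>alg. \<bar>p (A - S) - (\<Sum>i<N. a i * mu (A \<inter> C i))\<bar> \<le> (1/2)^j))"
  have "\<exists>x. P j x" for j :: nat
  proof -
    obtain S N C a where "S \<in> alg" "mu S \<le> (1/2)^j" "\<forall>i<N::nat. C i \<in> alg \<and> 0 \<le> a i"
      "\<forall>A\<in>alg. \<bar>p (A - S) - (\<Sum>i<N. a i * mu (A \<inter> C i))\<bar> \<le> (1/2)^j"
      using lebesgue_approx[OF p(1) fin_add_mu p(2) mu_UNIV, of "(1/2)^j"] by auto
    then have "P j (S, N, C, a)" by (simp add: P_def)
    then show ?thesis by blast
  qed
  then obtain g where g: "\<And>j. P j (g j)" by metis
  define S N C a where "S j = fst (g j)" and "N j = fst (snd (g j))"
    and "C j = fst (snd (snd (g j)))" and "a j = snd (snd (snd (g j)))" for j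
  have gS: "P j (S j, N j, C j, a j)" for j using g[of j] by (simp add: S_def N_def C_def a_def)
  have S: "S j \<in> alg" "mu (S j) \<le> (1/2)^j" for j using gS[of j] by (simp_all add: P_def)
  have C: "C j i \<in> alg \<and> 0 \<le> a j i" if "i < N j" for i j using gS[of j] that by (simp add: P_def)
  have app: "\<bar>p (A - S j) - (\<Sum>i<N j. a j i * mu (A \<inter> C j i))\<bar> \<le> (1/2)^j" if "A \<in> alg" for A j
    using gS[of j] that by (simp add: P_def)
  obtain d where d: "committed R f e d" "e d 0 = S" using commit[OF S] by blast
  obtain q where q: "\<And>j. q j \<in> atomic" "\<And>A. A \<in> alg \<Longrightarrow> (\<lambda>j. q j A - p (A \<inter> S j)) \<longlonglongrightarrow> 0"
    using atomic_approx_sequence[OF p(1) d(1)] unfolding d(2) by blast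
  define r where "r = (\<lambda>j A. (\<Sum>i<N j. a j i * mu (A \<inter> C j i)) + q j A)"
  have "p \<in> cone"
  proof (rule cone_limit[of r])
    show "r j \<in> cone" for j unfolding r_def by (rule cone_combination[OF C q(1)])
  next
    fix A assume A: "A \<in> alg"
    have "(\<lambda>j. (\<Sum>i<N j. a j i * mu (A \<inter> C j i)) - p (A - S j)) \<longlonglongrightarrow> 0"
      by (rule Lim_null_comparison[of _ "\<lambda>j. (1/2)^j"])
         (use app[OF A] in \<open>auto simp: abs_minus_commute LIMSEQ_power_zero\<close>)
    from tendsto_add[OF this q(2)[OF A]]
    have "(\<lambda>j. r j A - (p (A - S j) + p (A \<inter> S j))) \<longlonglongrightarrow> 0" by (simp add: r_def algebra_simps)
    moreover have "p (A - S j) + p (A \<inter> S j) = p A" for j using p.split[OF A S(1)[of j]] by linarith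
    ultimately show "(\<lambda>j. r j A) \<longlonglongrightarrow> p A" by (simp add: LIM_zero_iff)
  qed
  then have "p \<in> reach" using p(2) by (simp add: cone_def)
  then show "\<phi> \<in> seqcl X (coDelta X)" using reach_probm[OF \<phi>] by (simp add: p_def)
qed

section \<open>The limit \<open>mu\<close> is not a limit of finitely supported measures\<close>

text \<open>Each support point lies in a cylinder of density at most \<open>(1/2)^K\<close>;
  together these have density at most \<open>(1/2)^i\<close>, since
  \<open>card T \<le> 2^card T\<close>.\<close>

lemma coDelta_small_support:
  assumes "\<phi> \<in> coDelta X"
  shows "\<exists>Q\<in>balg gens. msr \<phi> Q = 1 \<and> (\<forall>n. lam n Q \<le> (1/2)^i)"
proof -
  obtain T where T: "finite T" "T \<subseteq> topspace X" "\<And>A. A \<in> alg \<Longrightarrow> T \<subseteq> c A \<Longrightarrow> msr \<phi> A = 1"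
    using coDelta_support[OF assms] by blast
  define K where "K = i + card T"
  have cyl: "cyl K r \<in> balg gens" for r by (intro balg.gen) (auto simp: gens_def)
  have cyl': "cyl K r \<in> alg" for r using cyl gens_alg by blast
  have "\<exists>r. x \<in> c (cyl K r)" if "x \<in> topspace X" for x
  proof -
    have "(\<Union>r\<in>{..<2^K}. cyl K r) = UNIV" by (auto simp: cyl_def)
    then have "c UNIV = (\<Union>r\<in>{..<2^K}. c (cyl K r))" using c_UN[of "{..<2^K}" "cyl K"] cyl' by simp
    then show ?thesis using that c_UNIV by blast
  qed
  then obtain r where r: "\<And>x. x \<in> T \<Longrightarrow> x \<in> c (cyl K (r x))" using T(2) by (metis subsetD)
  define Q where "Q = (\<Union>x\<in>T. cyl K (r x))"
  interpret g: algebra UNIV "balg gens" by (rule algebra_balg)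
  have Q: "Q \<in> balg gens" unfolding Q_def using T(1) cyl by (intro g.finite_UN) auto
  have "c Q = (\<Union>x\<in>T. c (cyl K (r x)))" unfolding Q_def using T(1) cyl' by (intro c_UN) auto
  then have "T \<subseteq> c Q" using r by blast
  then have "msr \<phi> Q = 1" using T(3) Q gens_alg by blast
  moreover have "lam n Q \<le> (1/2)^i" for n
  proof -
    interpret l: fin_add per "lam n" by (rule fin_add_lam)
    have "lam n Q \<le> (\<Sum>x\<in>T. lam n (cyl K (r x)))"
      unfolding Q_def using T(1) cyl gens_per by (intro l.subadd_UN) auto
    also have "\<dots> \<le> (\<Sum>x\<in>T. (1/2)^K)" by (intro sum_mono lam_cyl_le)
    also have "\<dots> = (1/2)^i * (real (card T) / 2^card T)" by (simp add: K_def power_add power_divide)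
    also have "real (card T) / 2^card T \<le> 1"
      using less_imp_le[OF of_nat_less_two_power[of "card T", where ?'a = real]] by simp
    then have "(1/2)^i * (real (card T) / 2^card T) \<le> (1/2)^i * 1" by (intro mult_left_mono) auto
    finally show ?thesis by simp
  qed
  ultimately show ?thesis using Q by blast
qed

text \<open>
  The supports of the \<open>\<nu> k\<close> are covered infinitely often by small sets \<open>S j\<close>. After committing to
  \<open>S\<close> at stage \<open>d\<close>, each \<open>\<nu> k\<close> is determined by its values on the countable algebra \<open>st d\<close>, so a
  single later task, listing the sets of \<open>st d\<close> of \<open>\<nu> k\<close>-measure above \<open>1/2\<close>, kills the sequence.
\<close>

lemma mu_not_seq1:
  assumes \<phi>: "\<And>A. A \<in> alg \<Longrightarrow> msr \<phi> A = mu A"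
  shows "\<phi> \<notin> seq1 X (coDelta X)"
proof
  assume "\<phi> \<in> seq1 X (coDelta X)"
  then obtain s where s: "\<And>k. s k \<in> coDelta X" "wconv X s \<phi>" unfolding seq1_def by blast
  define \<nu> where "\<nu> = (\<lambda>k. msr (s k))"
  have fa: "fin_add alg (\<nu> k)" and one: "\<nu> k UNIV = 1" for k
    unfolding \<nu>_def using msr_fin_add msr_UNIV s(1) coDelta_probm by blast+
  have lim: "(\<lambda>k. \<nu> k A) \<longlonglongrightarrow> mu A" if "A \<in> alg" for A
    unfolding \<phi>[OF that, symmetric] \<nu>_def msr_def
    using s(2) ind_cfun[OF that] by (simp add: wconv_def)
  \<comment> \<open>First components of decoded pairs, so that every \<open>k\<close> recurs at
    arbitrarily large \<open>j\<close>.\<close>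
  define kk where "kk = (\<lambda>j. fst (prod_decode j))"
  have kk: "\<exists>j\<ge>m. kk j = k" for k m
    by (rule exI[of _ "prod_encode (k, m)"]) (simp add: kk_def le_prod_encode_2)
  have "\<exists>Q\<in>balg gens. \<nu> (kk j) Q = 1 \<and> (\<forall>n. lam n Q \<le> (1/2)^j)" for j
    unfolding \<nu>_def by (rule coDelta_small_support[OF s(1)])
  then obtain S where S: "\<And>j. S j \<in> balg gens" "\<And>j. \<nu> (kk j) (S j) = 1" "\<And>j n. lam n (S j) \<le> (1/2)^j"
    by metis
  have S': "S j \<in> alg" for j using S(1) gens_alg by blast
  have "mu (S j) \<le> (1/2)^j" for j
    by (rule LIMSEQ_le_const2[OF lam_tendsto_mu[OF S']]) (use S(3) in blast)
  then obtain d where d: "\<And>j. S j \<in> st d" "committed R f e d" "e d 0 = S" using commit[of S] S' by blast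
  define \<F> where "\<F> = (\<lambda>k. {F \<in> st d. \<nu> k F > 1/2})"
  interpret d: algebra UNIV "st d" by (rule algebra_stage)
  have ne: "\<F> k \<noteq> {}" for k using one[of k] d.top by (auto simp: \<F>_def)
  have cnt: "countable (\<F> k)" for k
    using countable_stage[OF countable_below, of f d] by (auto simp: \<F>_def intro: countable_subset)
  define F where "F = (\<lambda>k. from_nat_into (\<F> k))"
  have rF: "range (F k) = \<F> k" for k unfolding F_def by (rule range_from_nat_into[OF ne cnt])
  \<comment> \<open>Row 0 repeats \<open>S\<close>; the shift in the other rows matches
    \<open>e y (Suc k)\<close>.\<close>
  obtain y where y: "(d, y) \<in> R" "e y = (\<lambda>i. if i = 0 then S else F (i - 1))"
    using cofinal by blast
  have ey: "(\<lambda>k. e y (Suc k)) = F" using y(2) by simp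
  have dy: "st d \<subseteq> st y" using st_le y(1) by blast
  have "concentrating (st y) F"
    unfolding concentrating_def
  proof (intro conjI allI ballI impI)
    show "F k l \<in> st y" for k l using rF[of k] dy unfolding \<F>_def by blast
  next
    fix V m assume V: "V \<in> st y" "mu V > 1/2"
    have Va: "V \<in> alg" using V(1) st_alg by blast
    have "\<forall>\<^sub>F k in sequentially. \<nu> k V > 1/2" using order_tendstoD(1)[OF lim[OF Va] V(2)] .
    then obtain k where k: "k \<ge> m" "\<nu> k V > 1/2" by (metis eventually_sequentially le_cases)
    interpret \<nu>: fin_add alg "\<nu> k" by (rule fa)
    \<comment> \<open>Half the excess of \<open>\<nu> k V\<close> over 1/2, so that losing
      \<open>\<delta>\<close> still leaves more than 1/2.\<close>
    define \<delta> where "\<delta> = (\<nu> k V - 1/2) / 2"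
    have \<delta>: "\<delta> > 0" using k by (simp add: \<delta>_def)
    obtain B B' j0 where B: "B \<in> st d" "B' \<in> st d" "B \<subseteq> V" "B' \<inter> V = {}"
      and j0: "\<And>j. j \<ge> j0 \<Longrightarrow> \<nu> k (S j - (B \<union> B')) \<le> \<delta>"
      using decided[OF fa d(2) Va \<delta>, of k] unfolding d(3) by blast
    have Ba: "B \<in> alg" "B' \<in> alg" using B st_alg by blast+
    obtain j where j: "j \<ge> max j0 m" "kk j = k" using kk by blast
    have Sj: "S j \<in> alg" "\<nu> k (S j) = 1" using S' S(2)[of j] j by auto
    have "\<nu> k (UNIV - S j) = 0" using \<nu>.diff[of UNIV "S j"] Sj one[of k] by simp
    then have zero: "\<nu> k (A - S j) = 0" if "A \<in> alg" for A
    proof -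
      have "A - S j \<in> alg" "UNIV - S j \<in> alg" using that Sj(1) by blast+
      then have "0 \<le> \<nu> k (A - S j)" "\<nu> k (A - S j) \<le> \<nu> k (UNIV - S j)"
        by (auto intro: \<nu>.nonneg \<nu>.mono)
      then show ?thesis using \<open>\<nu> k (UNIV - S j) = 0\<close> by linarith
    qed
    \<comment> \<open>All mass of \<open>\<nu> k\<close> sits on \<open>S j\<close>, so up to
      \<open>\<delta>\<close> the mass of \<open>V\<close> sits on \<open>B \<inter> S j\<close>, a
      set of \<open>st d\<close> that is as thin as \<open>S j\<close>.\<close>
    have "\<nu> k V = \<nu> k (V \<inter> S j)" using \<nu>.split[OF Va Sj(1)] zero[OF Va] by linarith
    also have "\<dots> \<le> \<nu> k ((B \<inter> S j) \<union> (S j - (B \<union> B')))"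
      by (rule \<nu>.mono) (use B(4) Va Ba Sj(1) in auto)
    also have "\<dots> \<le> \<nu> k (B \<inter> S j) + \<nu> k (S j - (B \<union> B'))"
      by (rule \<nu>.subadd) (use Ba Sj(1) in auto)
    also have "\<nu> k (S j - (B \<union> B')) \<le> \<delta>" using j0 j by simp
    finally have "\<nu> k (B \<inter> S j) > 1/2" using \<delta> by (simp add: \<delta>_def field_simps)
    then have "B \<inter> S j \<in> \<F> k" using B(1) d(1) by (auto simp: \<F>_def)
    then obtain l where l: "F k l = B \<inter> S j" using rF by (metis rangeE)
    have "lam n (F k l) \<le> (1/2)^m" for n
    proof -
      interpret l: fin_add per "lam n" by (rule fin_add_lam)
      have "lam n (F k l) \<le> lam n (S j)"
        unfolding l by (rule l.mono) (use Ba Sj(1) per_alg in auto)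
      also have "\<dots> \<le> (1/2)^j" by (rule S(3))
      also have "\<dots> \<le> (1/2)^m" using j by (intro power_decreasing) auto
      finally show ?thesis .
    qed
    moreover have "F k l \<subseteq> V" using l B(3) by auto
    ultimately show "\<exists>k\<ge>m. \<exists>l. F k l \<subseteq> V \<and> (\<forall>n. lam n (F k l) \<le> (1/2)^m)" using k(1) by blast
  qed
  then have kill: "mu (f y) \<le> 1/4" "\<And>m. \<exists>k\<ge>m. \<exists>l. F k l \<subseteq> f y"
    using extends[of y] unfolding extends_def ey fun_cong[OF ey, simplified] by auto
  \<comment> \<open>\<open>\<nu> k (f y)\<close> tends to \<open>mu (f y) \<le> 1/4\<close>, yet it
    exceeds 1/2 for infinitely many \<open>k\<close>.\<close>
  have "\<forall>\<^sub>F k in sequentially. \<nu> k (f y) < 1/2"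
    by (rule order_tendstoD(2)[OF lim[OF f_alg]]) (use kill(1) in simp)
  then obtain m where m: "\<And>k. k \<ge> m \<Longrightarrow> \<nu> k (f y) < 1/2" by (auto simp: eventually_sequentially)
  obtain k l where kl: "k \<ge> m" "F k l \<subseteq> f y" using kill(2) by blast
  have "F k l \<in> st d" "\<nu> k (F k l) > 1/2" using rF[of k] unfolding \<F>_def by blast+
  moreover have "\<nu> k (F k l) \<le> \<nu> k (f y)"
    by (rule fin_add.mono[OF fa _ f_alg kl(2)]) (use calculation(1) st_alg in blast)
  ultimately show False using m[OF kl(1)] by simp
qed

lemma seq1_neq: "seq1 X (coDelta X) \<noteq> seqcl X (coDelta X)"
proof -
  obtain \<phi> where "\<phi> \<in> seqcl X (coDelta X)" "\<And>A. A \<in> alg \<Longrightarrow> msr \<phi> A = mu A"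
    using mu_reach unfolding reach_def by blast
  then show ?thesis using mu_not_seq1 by blast
qed

end

theorem theorem2p7:
  assumes "CH"
  shows "\<exists>X :: real set set topology.
           compact_space X \<and> Hausdorff_space X \<and>
           seq1 X (coDelta X) \<noteq> seqcl X (coDelta X) \<and>
           seqcl X (coDelta X) = probm X"
proof -
  obtain R e f where "tower R e f" using tower_exists[OF assms] by blast
  then interpret tower R e f .
  \<comment> \<open>Sets of pairs are coded as sets of reals, so that points of the Stone space
    become elements of type \<open>real set set\<close>.\<close>
  have "inj (\<lambda>A :: (nat \<times> nat) set. (\<lambda>d. real (to_nat d)) ` A)"
    by (intro inj_image_eq_iff[THEN iffD1, THEN injI] injI) auto
  then obtain X :: "real set set topology" and c where "stone_space alg X c"
    using stone_space_exists[OF algebra_alg] by blast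
  then interpret stone_space alg X c .
  interpret tower_space R e f X c ..
  show ?thesis using compact Hausdorff seq1_neq probm_seqcl seqcl_probm by blast
qed

end
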